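(* Let $G$ be a polycyclic-by-finite group. Suppose that there are finitely many virtually cyclic subgroups $H_1,\dots,H_n$ of $G$ such that every virtually cyclic subgroup of $G$ is conjugate in $G$ to a subgroup of one of the $H_i$. Then $G$ is virtually cyclic.
   Context: A virtually cyclic group is one with a cyclic subgroup of finite index (finite groups are included). A group is polycyclic-by-finite if it has a polycyclic normal subgroup of finite index. *)

theory Defs
  imports "HOL-Algebra.Algebra"
begin

text \<open>A subgroup \<open>H\<close> of \<open>G\<close>, regarded as a group in its own right, is
  \<open>G\<lparr>carrier := H\<rparr>\<close>.\<close>

definition finite_index :: "'a set \<Rightarrow> ('a, 'b) monoid_scheme \<Rightarrow> bool"
  where "finite_index H G \<longleftrightarrow> subgroup H G \<and> finite (rcosets\<^bsub>G\<^esub> H)"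

definition virtually_cyclic :: "('a, 'b) monoid_scheme \<Rightarrow> bool"
  where "virtually_cyclic G \<longleftrightarrow>
    group G \<and> (\<exists>C. finite_index C G \<and> cyclic_group (G\<lparr>carrier := C\<rparr>))"

text \<open>\<open>polycyclic_seq G H\<close>: the subgroup \<open>H\<close> of \<open>G\<close> is the top of a finite series of subgroups
  that starts at the trivial subgroup, in which each term is normal in the next one with cyclic
  quotient (cf. \<^const>\<open>solvable_seq\<close>).\<close>

inductive polycyclic_seq :: "('a, 'b) monoid_scheme \<Rightarrow> 'a set \<Rightarrow> bool"
  for G where
    unity: "polycyclic_seq G {\<one>\<^bsub>G\<^esub>}"
  | extension: "\<lbrakk> polycyclic_seq G K; K \<lhd> (G\<lparr>carrier := H\<rparr>); subgroup H G;
                  cyclic_group ((G\<lparr>carrier := H\<rparr>) Mod K) \<rbrakk> \<Longrightarrow> polycyclic_seq G H"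

definition polycyclic :: "('a, 'b) monoid_scheme \<Rightarrow> bool"
  where "polycyclic G \<longleftrightarrow> group G \<and> polycyclic_seq G (carrier G)"

definition polycyclic_by_finite :: "('a, 'b) monoid_scheme \<Rightarrow> bool"
  where "polycyclic_by_finite G \<longleftrightarrow>
    group G \<and> (\<exists>N. N \<lhd> G \<and> finite_index N G \<and> polycyclic (G\<lparr>carrier := N\<rparr>))"

definition conjugate_in :: "('a, 'b) monoid_scheme \<Rightarrow> 'a set \<Rightarrow> 'a set \<Rightarrow> bool"
  where "conjugate_in G K L \<longleftrightarrow>
    (\<exists>g\<in>carrier G. L = g <#\<^bsub>G\<^esub> K #>\<^bsub>G\<^esub> inv\<^bsub>G\<^esub> g)"

end

theory Submission
  imports Defs
begin

text \<open>
  Being polycyclic-by-finite enters through two consequences: the maximal condition on subgroups,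
  and a finite-index normal subgroup whose derived series \<open>D\<close> consists of normal subgroups of \<open>G\<close>
  and reaches the trivial group.  The hypothesis on conjugacy enters through the cyclic subgroups:
  finitely many virtually cyclic subgroups meet every conjugacy class of elements.  In this form it
  passes to quotients.

  Suppose that \<open>G\<close> is not virtually cyclic.  By the maximal condition there is a normal
  subgroup \<open>M\<close>, maximal among those with \<open>G / M\<close> not virtually cyclic.  Replace \<open>G\<close> by \<open>G / M\<close>.
  Then every proper quotient is virtually cyclic, and the image of the last member of \<open>D\<close> that is
  not contained in \<open>M\<close> is a nontrivial abelian normal subgroup \<open>A\<close>; there is such a member because
  \<open>G / M\<close> is infinite.  The torsion of \<open>A\<close> is a finite normal subgroup, and
  a group with a finite normal subgroup and virtually cyclic quotient is virtually cyclic; so \<open>A\<close>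
  is torsion-free.  As \<open>G / A\<close> is virtually cyclic, some subgroup \<open>A\<langle>t\<rangle>\<close> has finite index.

  The contradiction is a count in \<open>A / A\<^sup>q\<close> for \<open>q = 2\<^sup>e\<close>.  If \<open>A / A\<^sup>2\<close> has at least \<open>c\<close>
  elements, then \<open>A / A\<^sup>q\<close> has at least \<open>c\<^sup>e\<close>, because \<open>A\<close> is torsion-free
  (\<open>separated_iterate\<close>); and \<open>c = 2\<close> is always possible (\<open>separated_pair\<close>).  If \<open>A / A\<^sup>2\<close> has at
  most two elements, then \<open>A\<close> has a cyclic subgroup of finite index
  (\<open>power_in_cyclic_if_generates_mod_squares\<close>), and otherwise \<open>c = 3\<close> is possible.

  If \<open>t\<^sup>i\<close> lies in \<open>A\<close> for some \<open>i \<noteq> 0\<close>, then \<open>A\<close> has finite index and is covered by finitely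
  many virtually cyclic subgroups, each of which meets at most a constant times \<open>q\<close> classes modulo
  \<open>A\<^sup>q\<close> (\<open>card_separated_in_vc_subgroup\<close>).  This is incompatible with \<open>3\<^sup>e\<close> classes, so \<open>A\<close>, hence
  \<open>G\<close>, has a cyclic subgroup of finite index.

  Otherwise \<open>t\<close> has infinite order modulo \<open>A\<close>.  Choose \<open>k > 0\<close> such that \<open>t\<^sup>k\<close> acts trivially on
  \<open>A / A\<^sup>q\<close>.  A virtually cyclic subgroup meets the coset \<open>A t\<^sup>k\<close> in at most one element
  (\<open>vc_subgroup_meets_coset_once\<close>), and modulo \<open>A\<^sup>q\<close> such an element has at most \<open>k\<close> conjugates
  under \<open>A\<langle>t\<rangle>\<close>.  So \<open>A / A\<^sup>q\<close> has at most a constant times \<open>k\<close> elements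
  (\<open>card_separated_le_if_infinite_order\<close>).  If \<open>A\<close> has a cyclic subgroup of finite index, then
  \<open>k = 2\<close> works for every \<open>q\<close>, whereas there are at least \<open>2\<^sup>e\<close> elements.  If not, the exponent \<open>k\<close>
  need only double when \<open>q\<close> doubles (\<open>acts_trivially_mod_square\<close>), so \<open>k\<close> is a constant times
  \<open>2\<^sup>e\<close>, whereas there are at least \<open>3\<^sup>e\<close> elements.
\<close>

section \<open>Finite index, virtually cyclic subgroups and conjugation\<close>

text \<open>Finiteness of a relative index, phrased inside the ambient group so that the members of a tower of
  subgroups can be compared without changing carriers.  The representatives may lie outside \<open>H\<close>.\<close>

definition finitely_many_cosets :: "('a, 'b) monoid_scheme \<Rightarrow> 'a set \<Rightarrow> 'a set \<Rightarrow> bool"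
  where "finitely_many_cosets G K H \<longleftrightarrow>
    (\<exists>R. finite R \<and> R \<subseteq> carrier G \<and> (\<forall>g\<in>H. \<exists>k\<in>K. \<exists>r\<in>R. g = k \<otimes>\<^bsub>G\<^esub> r))"

text \<open>Virtual cyclicity read inside the ambient group; in this form it is visibly preserved by
  homomorphisms, in particular by conjugation and by passage to a quotient.\<close>

definition vc_subgroup :: "('a, 'b) monoid_scheme \<Rightarrow> 'a set \<Rightarrow> bool"
  where "vc_subgroup G H \<longleftrightarrow>
    subgroup H G \<and> (\<exists>c\<in>H. finitely_many_cosets G (generate G {c}) H)"

definition conjugate :: "('a, 'b) monoid_scheme \<Rightarrow> 'a \<Rightarrow> 'a \<Rightarrow> 'a"
  where "conjugate G g x = g \<otimes>\<^bsub>G\<^esub> x \<otimes>\<^bsub>G\<^esub> inv\<^bsub>G\<^esub> g"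

context group
begin

lemma finite_index_iff_cosets:
  assumes H: "subgroup H G"
  shows "finite_index H G \<longleftrightarrow> finitely_many_cosets G H (carrier G)"
proof
  assume "finite_index H G"
  then have "finite ((\<lambda>r. H #> r) ` carrier G)"
    by (simp add: finite_index_def RCOSETS_def UNION_singleton_eq_range)
  then obtain R where R: "R \<subseteq> carrier G" "finite R"
    "(\<lambda>r. H #> r) ` carrier G = (\<lambda>r. H #> r) ` R"
    by (meson finite_subset_image subset_refl)
  have "\<exists>k\<in>H. \<exists>r\<in>R. g = k \<otimes> r" if g: "g \<in> carrier G" for g
  proof -
    obtain r where r: "r \<in> R" "H #> g = H #> r"
      using R(3) g by blast
    have "g \<in> H #> r"
      using rcos_self[OF g H] r(2) by simp
    then show ?thesis using r(1) unfolding r_coset_def by auto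
  qed
  then show "finitely_many_cosets G H (carrier G)"
    unfolding finitely_many_cosets_def using R by blast
next
  assume "finitely_many_cosets G H (carrier G)"
  then obtain R where R: "finite R" "R \<subseteq> carrier G"
    "\<And>g. g \<in> carrier G \<Longrightarrow> \<exists>k\<in>H. \<exists>r\<in>R. g = k \<otimes> r"
    unfolding finitely_many_cosets_def by blast
  have "rcosets H \<subseteq> (\<lambda>r. H #> r) ` R"
  proof
    fix C assume "C \<in> rcosets H"
    then obtain g where g: "g \<in> carrier G" "C = H #> g"
      unfolding RCOSETS_def by auto
    obtain k r where kr: "k \<in> H" "r \<in> R" "g = k \<otimes> r" using R(3) g(1) by blast
    have "g \<in> H #> r" using kr unfolding r_coset_def by auto
    then have "H #> r = H #> g"
      using repr_independence[of g H r] H R(2) kr(2) by auto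
    then show "C \<in> (\<lambda>r. H #> r) ` R" using g kr by auto
  qed
  then show "finite_index H G"
    unfolding finite_index_def using H R(1) finite_subset by blast
qed

lemma finitely_many_cosets_trans:
  assumes "K \<subseteq> carrier G" "finitely_many_cosets G K H" "finitely_many_cosets G H L"
  shows "finitely_many_cosets G K L"
proof -
  obtain R where R: "finite R" "R \<subseteq> carrier G" "\<And>g. g \<in> H \<Longrightarrow> \<exists>k\<in>K. \<exists>r\<in>R. g = k \<otimes> r"
    using assms(2) unfolding finitely_many_cosets_def by blast
  obtain S where S: "finite S" "S \<subseteq> carrier G" "\<And>g. g \<in> L \<Longrightarrow> \<exists>k\<in>H. \<exists>r\<in>S. g = k \<otimes> r"
    using assms(3) unfolding finitely_many_cosets_def by blast
  let ?T = "(\<lambda>(r, s). r \<otimes> s) ` (R \<times> S)"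
  have "\<exists>k\<in>K. \<exists>t\<in>?T. g = k \<otimes> t" if g: "g \<in> L" for g
  proof -
    obtain h s where hs: "h \<in> H" "s \<in> S" "g = h \<otimes> s" using S(3) g by blast
    obtain k r where kr: "k \<in> K" "r \<in> R" "h = k \<otimes> r" using R(3) hs(1) by blast
    have "g = k \<otimes> (r \<otimes> s)"
      unfolding hs(3) kr(3) using kr hs R(2) S(2) assms(1) by (intro m_assoc) auto
    then show ?thesis using kr hs by force
  qed
  moreover have "?T \<subseteq> carrier G" using R(2) S(2) by auto
  ultimately show ?thesis
    unfolding finitely_many_cosets_def using R(1) S(1) by (intro exI[of _ ?T]) simp
qed

lemma finitely_many_cosets_mono:
  assumes "finitely_many_cosets G K H" "K \<subseteq> K'" "H' \<subseteq> H"
  shows "finitely_many_cosets G K' H'"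
proof -
  obtain R where R: "finite R" "R \<subseteq> carrier G" "\<And>g. g \<in> H \<Longrightarrow> \<exists>k\<in>K. \<exists>r\<in>R. g = k \<otimes> r"
    using assms(1) unfolding finitely_many_cosets_def by blast
  then have "\<exists>k\<in>K'. \<exists>r\<in>R. g = k \<otimes> r" if "g \<in> H'" for g
    using assms(2,3) that by (meson subsetD)
  then show ?thesis
    unfolding finitely_many_cosets_def using R(1,2) by (intro exI[of _ R]) simp
qed

lemma finitely_many_cosets_refl:
  assumes "H \<subseteq> carrier G" shows "finitely_many_cosets G H H"
proof -
  have "\<exists>k\<in>H. \<exists>r\<in>{\<one>}. g = k \<otimes> r" if "g \<in> H" for g
    using assms that by (simp add: subset_iff)
  then show ?thesis
    unfolding finitely_many_cosets_def by (intro exI[of _ "{\<one>}"]) simp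
qed

text \<open>Pigeonhole principle: two powers of \<open>y\<close> share a coset representative, and their quotient lies in
  \<open>K\<close>.\<close>

lemma power_in_finite_index_subgroup:
  assumes K: "subgroup K G" and fin: "finitely_many_cosets G K H"
    and H: "subgroup H G" and y: "y \<in> H"
  obtains s :: nat where "s > 0" "y [^] s \<in> K"
proof -
  have yG: "y \<in> carrier G" using H y by (simp add: subgroup.mem_carrier)
  obtain R where R: "finite R" "R \<subseteq> carrier G" "\<And>g. g \<in> H \<Longrightarrow> \<exists>k\<in>K. \<exists>r\<in>R. g = k \<otimes> r"
    using fin unfolding finitely_many_cosets_def by blast
  have "\<exists>r\<in>R. \<exists>k\<in>K. y [^] u = k \<otimes> r" for u :: nat
    using R(3)[of "y [^] u"] subgroup_int_pow_closed[OF H y, of "int u"] by (auto simp: int_pow_int)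
  then obtain r where r: "\<And>u :: nat. r u \<in> R \<and> (\<exists>k\<in>K. y [^] u = k \<otimes> r u)" by metis
  have "finite (range r)" using R(1) r by (meson finite_subset image_subsetI)
  then have "\<not> inj r" using finite_imageD infinite_UNIV_nat by blast
  then obtain u v where uv: "u < v" "r u = r v"
    unfolding inj_on_def by (metis linorder_neqE_nat)
  obtain k l where kl: "k \<in> K" "l \<in> K" "y [^] u = k \<otimes> r u" "y [^] v = l \<otimes> r u"
    using r uv(2) by metis
  have c: "k \<in> carrier G" "l \<in> carrier G" "r u \<in> carrier G"
    using kl K R(2) r by (auto simp: subgroup.mem_carrier)
  have "y [^] (v - u) \<otimes> y [^] u = y [^] v"
    using uv(1) yG by (simp add: nat_pow_mult)
  then have "y [^] (v - u) \<otimes> k \<otimes> r u = l \<otimes> r u"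
    using kl c yG by (simp add: m_assoc)
  then have "y [^] (v - u) \<otimes> k = l"
    using c yG by simp
  then have "y [^] (v - u) = l \<otimes> inv k"
    using c yG inv_solve_right[of "y [^] (v - u)" l k] by simp
  then have "y [^] (v - u) \<in> K"
    using K kl by (simp add: subgroup.m_closed subgroup.m_inv_closed)
  then show thesis using that[of "v - u"] uv(1) by simp
qed

lemma virtually_cyclicI:
  assumes c: "c \<in> carrier G" and fin: "finitely_many_cosets G (generate G {c}) (carrier G)"
  shows "virtually_cyclic G"
proof -
  have "subgroup (generate G {c}) G" using c by (simp add: generate_is_subgroup)
  moreover have "G\<lparr>carrier := generate G {c}\<rparr> = subgroup_generated G {c}"
    using c by (simp add: subgroup_generated_def)
  ultimately show ?thesis
    unfolding virtually_cyclic_def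
    using finite_index_iff_cosets[of "generate G {c}"] fin cyclic_group_generated[of c]
    by (intro conjI is_group exI[of _ "generate G {c}"]) simp_all
qed

lemma virtually_cyclic_generate:
  assumes x: "x \<in> carrier G"
  shows "virtually_cyclic (G\<lparr>carrier := generate G {x}\<rparr>)"
proof -
  let ?X = "generate G {x}"
  have X: "subgroup ?X G" using x by (simp add: generate_is_subgroup)
  then interpret X: group "G\<lparr>carrier := ?X\<rparr>" by (rule subgroup_imp_group)
  have xX: "x \<in> ?X" by (simp add: generate.incl)
  have "generate (G\<lparr>carrier := ?X\<rparr>) {x} = ?X"
    using generate_consistent[of "{x}" ?X] xX X by simp
  then show ?thesis
    using X.virtually_cyclicI[of x] X.finitely_many_cosets_refl[of ?X] xX by simp
qed

lemma vc_subgroupI: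
  assumes H: "subgroup H G" and vc: "virtually_cyclic (G\<lparr>carrier := H\<rparr>)"
  shows "vc_subgroup G H"
proof -
  interpret H: group "G\<lparr>carrier := H\<rparr>" using H by (rule subgroup_imp_group)
  obtain C where C: "finite_index C (G\<lparr>carrier := H\<rparr>)"
    "cyclic_group (G\<lparr>carrier := H\<rparr>\<lparr>carrier := C\<rparr>)"
    using vc unfolding virtually_cyclic_def by blast
  have sC: "subgroup C (G\<lparr>carrier := H\<rparr>)" using C(1) by (simp add: finite_index_def)
  have CH: "C \<subseteq> H" using subgroup.subset[OF sC] by simp
  have CG: "subgroup C G" using group.incl_subgroup[OF is_group H sC] .
  interpret C: group "G\<lparr>carrier := C\<rparr>" using CG by (rule subgroup_imp_group)
  obtain c where c: "c \<in> C" "C = range (\<lambda>n::int. c [^]\<^bsub>G\<lparr>carrier := C\<rparr>\<^esub> n)"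
    using C(2) C.cyclic_group by auto
  have "c [^]\<^bsub>G\<lparr>carrier := C\<rparr>\<^esub> n = c [^] n" for n :: int
    using int_pow_consistent[OF CG c(1)] by simp
  then have "C = generate G {c}"
    using c CG generate_pow[of c] by (auto simp: subgroup.mem_carrier)
  moreover have "finitely_many_cosets G C H"
    using H.finite_index_iff_cosets[OF sC] C(1) H
    unfolding finitely_many_cosets_def by (auto dest: subgroup.subset)
  ultimately show ?thesis
    unfolding vc_subgroup_def using H c(1) CH by blast
qed

lemma nat_torsion_if_int_torsion:
  assumes x: "x \<in> carrier G" and i: "x [^] (i::int) = \<one>" "i \<noteq> 0"
  obtains n :: nat where "n > 0" "x [^] n = \<one>"
proof -
  have "x [^] \<bar>i\<bar> = \<one>" using x i(1) by (simp add: abs_if int_pow_neg)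
  then have "x [^] nat \<bar>i\<bar> = \<one>" by (simp flip: int_pow_int)
  then show thesis using that[of "nat \<bar>i\<bar>"] i(2) by simp
qed

lemma mult_inv_cancel [simp]:
  assumes "x \<in> carrier G" "y \<in> carrier G"
  shows "inv x \<otimes> (x \<otimes> y) = y" "x \<otimes> (inv x \<otimes> y) = y"
  using assms by (simp_all flip: m_assoc)

lemma conjugate_hom:
  assumes g: "g \<in> carrier G" shows "group_hom G G (conjugate G g)"
proof (intro group_hom.intro group_hom_axioms.intro homI is_group)
  fix x y assume xy: "x \<in> carrier G" "y \<in> carrier G"
  have "conjugate G g x \<otimes> conjugate G g y = g \<otimes> x \<otimes> (inv g \<otimes> g) \<otimes> (y \<otimes> inv g)"
    unfolding conjugate_def using g xy by (simp only: m_assoc m_closed inv_closed)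
  also have "\<dots> = conjugate G g (x \<otimes> y)"
    unfolding conjugate_def using g xy by (simp add: m_assoc)
  finally show "conjugate G g (x \<otimes> y) = conjugate G g x \<otimes> conjugate G g y" by simp
qed (simp add: g conjugate_def)

lemma conjugate_closed [simp, intro]:
  "\<lbrakk>g \<in> carrier G; x \<in> carrier G\<rbrakk> \<Longrightarrow> conjugate G g x \<in> carrier G"
  by (simp add: conjugate_def)

lemma conjugate_mult:
  "\<lbrakk>g \<in> carrier G; x \<in> carrier G; y \<in> carrier G\<rbrakk>
    \<Longrightarrow> conjugate G g (x \<otimes> y) = conjugate G g x \<otimes> conjugate G g y"
  using group_hom.hom_mult[OF conjugate_hom] by simp

lemma conjugate_inv:
  "\<lbrakk>g \<in> carrier G; x \<in> carrier G\<rbrakk> \<Longrightarrow> conjugate G g (inv x) = inv (conjugate G g x)"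
  using group_hom.hom_inv[OF conjugate_hom] by simp

lemma conjugate_nat_pow:
  "\<lbrakk>g \<in> carrier G; x \<in> carrier G\<rbrakk> \<Longrightarrow> conjugate G g (x [^] (n::nat)) = conjugate G g x [^] n"
  using group_hom.hom_nat_pow[OF conjugate_hom] by simp

lemma conjugate_int_pow:
  "\<lbrakk>g \<in> carrier G; x \<in> carrier G\<rbrakk> \<Longrightarrow> conjugate G g (x [^] (n::int)) = conjugate G g x [^] n"
  using group_hom.hom_int_pow[OF conjugate_hom] by simp

lemma conjugate_conjugate:
  "\<lbrakk>g \<in> carrier G; h \<in> carrier G; x \<in> carrier G\<rbrakk>
    \<Longrightarrow> conjugate G g (conjugate G h x) = conjugate G (g \<otimes> h) x"
  by (simp add: conjugate_def m_assoc inv_mult_group)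

lemma conjugate_one [simp]: "x \<in> carrier G \<Longrightarrow> conjugate G \<one> x = x"
  by (simp add: conjugate_def)

lemma conjugate_inv_cancel [simp]:
  "\<lbrakk>g \<in> carrier G; x \<in> carrier G\<rbrakk> \<Longrightarrow> conjugate G (inv g) (conjugate G g x) = x"
  "\<lbrakk>g \<in> carrier G; x \<in> carrier G\<rbrakk> \<Longrightarrow> conjugate G g (conjugate G (inv g) x) = x"
  by (simp_all add: conjugate_conjugate)

lemma normal_conjugate_closed:
  "\<lbrakk>N \<lhd> G; g \<in> carrier G; x \<in> N\<rbrakk> \<Longrightarrow> conjugate G g x \<in> N"
  unfolding conjugate_def normal_inv_iff by blast

lemma normalI_conjugate:
  "\<lbrakk>subgroup N G; \<And>g x. g \<in> carrier G \<Longrightarrow> x \<in> N \<Longrightarrow> conjugate G g x \<in> N\<rbrakk> \<Longrightarrow> N \<lhd> G"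
  unfolding conjugate_def normal_inv_iff by blast

end

lemma (in group_hom) finitely_many_cosets_image:
  assumes "K \<subseteq> carrier G" "finitely_many_cosets G K L"
  shows "finitely_many_cosets H (h ` K) (h ` L)"
proof -
  obtain R where R: "finite R" "R \<subseteq> carrier G" "\<And>g. g \<in> L \<Longrightarrow> \<exists>k\<in>K. \<exists>r\<in>R. g = k \<otimes> r"
    using assms(2) unfolding finitely_many_cosets_def by blast
  have "\<exists>k\<in>h ` K. \<exists>r\<in>h ` R. y = k \<otimes>\<^bsub>H\<^esub> r" if y: "y \<in> h ` L" for y
  proof -
    obtain g where g: "g \<in> L" "y = h g" using y by (meson imageE)
    obtain k r where kr: "k \<in> K" "r \<in> R" "g = k \<otimes> r" using R(3) g(1) by blast
    then have "y = h k \<otimes>\<^bsub>H\<^esub> h r" using g assms(1) R(2) by (metis hom_mult subsetD)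
    then show ?thesis using kr by blast
  qed
  then show ?thesis
    unfolding finitely_many_cosets_def using R(1,2) by (intro exI[of _ "h ` R"]) auto
qed

lemma (in group_hom) vc_subgroup_image:
  assumes "vc_subgroup G L" shows "vc_subgroup H (h ` L)"
proof -
  obtain c where L: "subgroup L G" and c: "c \<in> L" "finitely_many_cosets G (generate G {c}) L"
    using assms unfolding vc_subgroup_def by blast
  have cG: "c \<in> carrier G" using L c(1) by (simp add: subgroup.mem_carrier)
  have "h ` generate G {c} = generate H {h c}"
    using generate_img[of "{c}"] cG by simp
  then have "finitely_many_cosets H (generate H {h c}) (h ` L)"
    using finitely_many_cosets_image[OF _ c(2)] cG
    by (simp add: G.generate_incl)
  then show ?thesis
    unfolding vc_subgroup_def using c(1) L subgroup_img_is_subgroup by blast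
qed

section \<open>The maximal condition on subgroups\<close>

text \<open>The maximal condition is stated with chains rather than with maximal elements, because chains
  are easily intersected with a subgroup and pulled back along a homomorphism.\<close>

definition max_condition :: "('a, 'b) monoid_scheme \<Rightarrow> 'a set \<Rightarrow> bool"
  where "max_condition G H \<longleftrightarrow>
    (\<forall>f :: nat \<Rightarrow> 'a set. (\<forall>i. subgroup (f i) G \<and> f i \<subseteq> H \<and> f i \<subseteq> f (Suc i))
      \<longrightarrow> (\<exists>m. \<forall>i\<ge>m. f i = f m))"

context group
begin

lemma max_condition_maximal:
  assumes max: "max_condition G (carrier G)" and P: "P K" and sub: "\<And>K. P K \<Longrightarrow> subgroup K G"
  obtains M where "P M" "\<And>L. P L \<Longrightarrow> M \<subseteq> L \<Longrightarrow> L = M"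
proof -
  have "wf {(L, M). P L \<and> P M \<and> M \<subset> L}"
    unfolding wf_iff_no_infinite_down_chain
  proof
    assume "\<exists>f. \<forall>i. (f (Suc i), f i) \<in> {(L, M). P L \<and> P M \<and> M \<subset> L}"
    then obtain f where f: "\<And>i. P (f (Suc i)) \<and> P (f i) \<and> f i \<subset> f (Suc i)" by auto
    then have "\<forall>i. subgroup (f i) G \<and> f i \<subseteq> carrier G \<and> f i \<subseteq> f (Suc i)"
      using sub subgroup.subset psubset_imp_subset by meson
    then obtain m where "\<forall>i\<ge>m. f i = f m"
      using max[unfolded max_condition_def, rule_format, of f] by blast
    then have "f (Suc m) = f m" using le_SucI by blast
    then show False using f[of m] by blast
  qed
  then obtain M where "M \<in> Collect P" "\<And>L. (L, M) \<in> {(L, M). P L \<and> P M \<and> M \<subset> L} \<Longrightarrow> L \<notin> Collect P"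
    using wfE_min[of _ K "Collect P"] P by (metis (no_types, lifting) mem_Collect_eq)
  then show thesis using that[of M] by auto
qed

lemma max_condition_subgroup:
  assumes H: "subgroup H G" and K: "K \<subseteq> H"
  shows "max_condition (G\<lparr>carrier := H\<rparr>) K \<longleftrightarrow> max_condition G K"
proof -
  have "subgroup L (G\<lparr>carrier := H\<rparr>) \<longleftrightarrow> subgroup L G" if "L \<subseteq> K" for L
    using that H K incl_subgroup subgroup_incl by (meson order_trans)
  then show ?thesis unfolding max_condition_def by metis
qed

text \<open>The traces of a chain on \<open>K\<close> become stationary, and each of the finitely many cosets of \<open>K\<close> that
  the chain ever meets is met from some stage on.  A later element then differs from an element of
  that stage by a member of \<open>K\<close>.\<close>

lemma max_condition_finite_extension:
  assumes K: "subgroup K G" and max: "max_condition G K"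
    and fin: "finitely_many_cosets G K (carrier G)"
  shows "max_condition G (carrier G)"
  unfolding max_condition_def
proof (intro allI impI)
  fix f :: "nat \<Rightarrow> 'a set"
  assume f: "\<forall>i. subgroup (f i) G \<and> f i \<subseteq> carrier G \<and> f i \<subseteq> f (Suc i)"
  have mono: "f i \<subseteq> f j" if "i \<le> j" for i j
    using lift_Suc_mono_le[of f] f that by blast
  have "\<forall>i. subgroup (f i \<inter> K) G \<and> f i \<inter> K \<subseteq> K \<and> f i \<inter> K \<subseteq> f (Suc i) \<inter> K"
    using f K subgroups_Inter_pair by blast
  then obtain m where m: "\<forall>i\<ge>m. f i \<inter> K = f m \<inter> K"
    using max[unfolded max_condition_def, rule_format, of "\<lambda>i. f i \<inter> K"] by auto
  obtain R where R: "finite R" "R \<subseteq> carrier G"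
    "\<And>g. g \<in> carrier G \<Longrightarrow> \<exists>k\<in>K. \<exists>r\<in>R. g = k \<otimes> r"
    using fin unfolding finitely_many_cosets_def by blast
  define stage where "stage r = (LEAST i. \<exists>k\<in>K. k \<otimes> r \<in> f i)" for r
  define N where "N = Max (insert m (stage ` R))"
  have N: "m \<le> N" "\<And>r. r \<in> R \<Longrightarrow> stage r \<le> N"
    unfolding N_def using R(1) by auto
  have "f i \<subseteq> f N" if i: "i \<ge> N" for i
  proof
    fix g assume g: "g \<in> f i"
    then have gG: "g \<in> carrier G" using f by blast
    then obtain k r where kr: "k \<in> K" "r \<in> R" "g = k \<otimes> r" using R(3) by blast
    then have "\<exists>k\<in>K. k \<otimes> r \<in> f (stage r)"
      unfolding stage_def by (intro LeastI[of "\<lambda>i. \<exists>k\<in>K. k \<otimes> r \<in> f i" i]) (use g in blast)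
    then obtain l where l: "l \<in> K" "l \<otimes> r \<in> f N"
      using mono[OF N(2)[OF kr(2)]] by blast
    then have li: "l \<otimes> r \<in> f i" using mono[OF i] by blast
    have c: "k \<in> carrier G" "l \<in> carrier G" "r \<in> carrier G"
      using kr l R(2) K by (auto simp: subgroup.mem_carrier)
    have "g \<otimes> inv (l \<otimes> r) = k \<otimes> inv l"
      unfolding kr(3) using c by (simp add: inv_mult_group m_assoc)
    moreover have "k \<otimes> inv l \<in> K"
      using K kr(1) l(1) by (simp add: subgroup.m_closed subgroup.m_inv_closed)
    moreover have "g \<otimes> inv (l \<otimes> r) \<in> f i"
      using f g li by (simp add: subgroup.m_closed subgroup.m_inv_closed)
    ultimately have "g \<otimes> inv (l \<otimes> r) \<in> f N"
      using m i N(1) by (metis Int_iff order_trans)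
    then have "g \<otimes> inv (l \<otimes> r) \<otimes> (l \<otimes> r) \<in> f N"
      using l f by (simp add: subgroup.m_closed)
    then show "g \<in> f N" using c gG by (simp add: m_assoc)
  qed
  then show "\<exists>m. \<forall>i\<ge>m. f i = f m"
    using mono by (meson subset_antisym)
qed

text \<open>The traces of a chain on \<open>K\<close> become stationary.  The images of the chain in the cyclic group
  \<open>G / K\<close> behave like an increasing sequence of ideals of the integers: a least positive exponent
  \<open>d\<close> occurring anywhere in the chain divides all exponents that occur.\<close>

lemma max_condition_cyclic_extension:
  assumes K: "K \<lhd> G" and max: "max_condition G K" and cyc: "cyclic_group (G Mod K)"
  shows "max_condition G (carrier G)"
  unfolding max_condition_def
proof (intro allI impI)
  interpret K: normal K G by (rule K)
  interpret Q: group "G Mod K" by (rule K.factorgroup_is_group)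
  fix f :: "nat \<Rightarrow> 'a set"
  assume f: "\<forall>i. subgroup (f i) G \<and> f i \<subseteq> carrier G \<and> f i \<subseteq> f (Suc i)"
  have mono: "f i \<subseteq> f j" if "i \<le> j" for i j
    using lift_Suc_mono_le[of f] f that by blast
  have "\<forall>i. subgroup (f i \<inter> K) G \<and> f i \<inter> K \<subseteq> K \<and> f i \<inter> K \<subseteq> f (Suc i) \<inter> K"
    using f K.subgroup_axioms subgroups_Inter_pair by blast
  then obtain m where m: "\<forall>i\<ge>m. f i \<inter> K = f m \<inter> K"
    using max[unfolded max_condition_def, rule_format, of "\<lambda>i. f i \<inter> K"] by auto
  obtain t where t: "t \<in> carrier G"
    and gen: "carrier (G Mod K) = range (\<lambda>n::int. (K #> t) [^]\<^bsub>G Mod K\<^esub> n)"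
    using cyc unfolding Q.cyclic_group by (auto simp: carrier_FactGroup)
  have gen: "\<exists>j::int. K #> g = K #> t [^] j" if "g \<in> carrier G" for g
  proof -
    have "K #> g \<in> range (\<lambda>n::int. (K #> t) [^]\<^bsub>G Mod K\<^esub> n)"
      using that by (simp flip: gen add: carrier_FactGroup)
    then show ?thesis using K.FactGroup_int_pow[OF t] by auto
  qed
  have inK: "x \<in> K" if "x \<in> carrier G" "K #> x = K #> \<one>" for x
    using rcos_self[OF that(1) K.subgroup_axioms] that(2) K.subset by simp
  have pw: "K #> x [^] i = K #> y [^] i"
    if "x \<in> carrier G" "y \<in> carrier G" "K #> x = K #> y" for x y and i :: int
    using that K.FactGroup_int_pow by metis
  have mult: "K #> (x \<otimes> y) = K #> (x' \<otimes> y')"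
    if "x \<in> carrier G" "y \<in> carrier G" "x' \<in> carrier G" "y' \<in> carrier G"
      "K #> x = K #> x'" "K #> y = K #> y'" for x y x' y'
    using that K.rcos_sum by metis
  show "\<exists>m. \<forall>i\<ge>m. f i = f m"
  proof (cases "\<exists>d::nat. d > 0 \<and> (\<exists>i. \<exists>x\<in>f i. K #> x = K #> t [^] int d)")
    case False
    have "f i \<subseteq> K" for i
    proof
      fix g assume g: "g \<in> f i"
      then have gG: "g \<in> carrier G" using f by blast
      obtain j :: int where j: "K #> g = K #> t [^] j" using gen gG by blast
      have "\<not> j > 0" using False g j by (metis pos_int_cases)
      moreover have "\<not> j < 0"
      proof
        assume "j < 0"
        have "K #> inv g = K #> t [^] (- j)"
          using pw[OF gG _ j, of "-1"] gG t int_pow_neg[of g 1] by (simp add: int_pow_pow)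
        moreover have "inv g \<in> f i" using f g by (simp add: subgroup.m_inv_closed)
        ultimately show False using False \<open>j < 0\<close>
          by (metis neg_0_less_iff_less pos_int_cases)
      qed
      ultimately have "j = 0" by simp
      then show "g \<in> K" using inK gG j by simp
    qed
    then have "f i \<inter> K = f i" for i by blast
    then show ?thesis using m by metis
  next
    case True
    define d where "d = (LEAST d::nat. d > 0 \<and> (\<exists>i. \<exists>x\<in>f i. K #> x = K #> t [^] int d))"
    have d: "d > 0 \<and> (\<exists>i. \<exists>x\<in>f i. K #> x = K #> t [^] int d)"
      unfolding d_def by (rule LeastI_ex[OF True])
    then obtain n w where w: "w \<in> f n" "K #> w = K #> t [^] int d" by blast
    have wG: "w \<in> carrier G" using w f by blast
    define N where "N = max m n"
    have "f i \<subseteq> f N" if i: "i \<ge> N" for i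
    proof
      fix g assume g: "g \<in> f i"
      then have gG: "g \<in> carrier G" using f by blast
      obtain j :: int where j: "K #> g = K #> t [^] j" using gen gG by blast
      \<comment> \<open>Subtracting the multiple \<open>q\<close> of the least exponent leaves a remainder smaller than it.\<close>
      define q where "q = j div int d"
      define \<rho> where "\<rho> = nat (j mod int d)"
      have \<rho>: "int \<rho> = j mod int d" "\<rho> < d"
        unfolding \<rho>_def using d by (auto simp: nat_less_iff)
      have wN: "w \<in> f N" using w(1) mono[of n N] unfolding N_def by auto
      then have wqN: "w [^] (- q) \<in> f N" for q :: int
        using f subgroup_int_pow_closed by blast
      have "K #> (w [^] (- q)) = K #> (t [^] int d) [^] (- q)"
        using pw[OF wG _ w(2)] t by simp
      also have "\<dots> = K #> t [^] (- (int d * q))" using t by (simp add: int_pow_pow)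
      finally have "K #> (g \<otimes> w [^] (- q)) = K #> (t [^] j \<otimes> t [^] (- (int d * q)))"
        using mult[OF gG _ _ _ j] wG t by simp
      also have "t [^] j \<otimes> t [^] (- (int d * q)) = t [^] int \<rho>"
        using t \<rho>(1) by (simp flip: int_pow_mult add: q_def minus_mult_div_eq_mod)
      finally have rem: "K #> (g \<otimes> w [^] (- q)) = K #> t [^] int \<rho>" .
      have "w [^] (- q) \<in> f i" using wqN mono[OF i] by blast
      then have in_i: "g \<otimes> w [^] (- q) \<in> f i" using f g by (simp add: subgroup.m_closed)
      have "\<rho> = 0"
      proof (rule ccontr)
        assume "\<rho> \<noteq> 0"
        then have "d \<le> \<rho>"
          unfolding d_def using in_i rem by (intro Least_le) blast
        then show False using \<rho>(2) by simp
      qed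
      then have "g \<otimes> w [^] (- q) \<in> K" using inK rem gG wG by simp
      then have "g \<otimes> w [^] (- q) \<in> f N"
        using m in_i i unfolding N_def by (metis Int_iff max.bounded_iff max.cobounded1)
      then have "g \<otimes> w [^] (- q) \<otimes> w [^] (- (- q)) \<in> f N"
        using wqN[of "- q"] f by (simp add: subgroup.m_closed)
      then show "g \<in> f N" using gG wG by (simp add: m_assoc flip: int_pow_mult)
    qed
    then show ?thesis using mono by (meson subset_antisym)
  qed
qed

lemma polycyclic_seq_max_condition:
  assumes "polycyclic_seq G H" shows "max_condition G H"
  using assms
proof induction
  case unity
  have "f i = {\<one>}" if "subgroup (f i) G" "f i \<subseteq> {\<one>}" for f :: "nat \<Rightarrow> 'a set" and i
    using that subgroup.one_closed by blast
  then show ?case unfolding max_condition_def by metis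
next
  case (extension K H)
  interpret H: group "G\<lparr>carrier := H\<rparr>" using extension by (simp add: subgroup_imp_group)
  have "K \<subseteq> H"
    using extension(2) normal_imp_subgroup subgroup.subset by fastforce
  then show ?case
    using H.max_condition_cyclic_extension[OF extension(2) _ extension(4)]
      max_condition_subgroup[OF extension(3)] extension by simp
qed

lemma polycyclic_by_finite_max_condition:
  assumes "polycyclic_by_finite G" shows "max_condition G (carrier G)"
proof -
  obtain N where N: "N \<lhd> G" "finite_index N G" "polycyclic (G\<lparr>carrier := N\<rparr>)"
    using assms unfolding polycyclic_by_finite_def by blast
  have sN: "subgroup N G" using N(1) by (rule normal_imp_subgroup)
  interpret N: group "G\<lparr>carrier := N\<rparr>" using sN by (rule subgroup_imp_group)
  have "max_condition (G\<lparr>carrier := N\<rparr>) N"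
    using N.polycyclic_seq_max_condition N(3) unfolding polycyclic_def by simp
  then show ?thesis
    using max_condition_finite_extension sN max_condition_subgroup N(2) finite_index_iff_cosets by blast
qed

text \<open>The terms of the derived series of a normal subgroup are normal in the whole group, unlike the
  terms of an arbitrary polycyclic series.\<close>

lemma polycyclic_by_finite_derived_series:
  assumes "polycyclic_by_finite G"
  obtains D :: "nat \<Rightarrow> 'a set" and n where
    "\<And>i. D i \<lhd> G" "D n = {\<one>}" "finitely_many_cosets G (D 0) (carrier G)"
    "\<And>i x y. x \<in> D i \<Longrightarrow> y \<in> D i \<Longrightarrow> x \<otimes> y \<otimes> inv x \<otimes> inv y \<in> D (Suc i)"
proof -
  obtain N where N: "N \<lhd> G" "finite_index N G" "polycyclic (G\<lparr>carrier := N\<rparr>)"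
    using assms unfolding polycyclic_by_finite_def by blast
  have sN: "subgroup N G" using N(1) by (rule normal_imp_subgroup)
  interpret N: group "G\<lparr>carrier := N\<rparr>" using sN by (rule subgroup_imp_group)
  have solv: "solvable_seq (G\<lparr>carrier := N\<rparr>) H" if "polycyclic_seq (G\<lparr>carrier := N\<rparr>) H" for H
    using that
  proof induction
    case unity show ?case by (rule solvable_seq.unity)
  next
    case (extension K H)
    then show ?case using solvable_seq.extension cyclic_imp_abelian_group
      by (metis N.subgroup_imp_group normal.factorgroup_is_group group.cyclic_imp_abelian_group)
  qed
  then obtain n where n: "(derived (G\<lparr>carrier := N\<rparr>) ^^ n) N = {\<one>}"
    using N.solvable_imp_trivial_derived_seq N(3) unfolding polycyclic_def by fastforce
  define D where "D i = (derived G ^^ i) N" for i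
  have D: "D i \<lhd> G" "(derived (G\<lparr>carrier := N\<rparr>) ^^ i) N = D i \<and> D i \<subseteq> N" for i
  proof -
    show "D i \<lhd> G" unfolding D_def
      by (induction i) (use N(1) derived_is_normal in auto)
    show "(derived (G\<lparr>carrier := N\<rparr>) ^^ i) N = D i \<and> D i \<subseteq> N"
    proof (induction i)
      case (Suc i)
      then show ?case using derived_consistent[OF _ sN, of "D i"] derived_incl[OF _ sN, of "D i"]
        by (simp add: D_def)
    qed (simp add: D_def)
  qed
  show thesis
  proof (rule that[of D n])
    show "D n = {\<one>}" using D(2)[of n] n by simp
    show "finitely_many_cosets G (D 0) (carrier G)"
      using N(2) sN finite_index_iff_cosets by (simp add: D_def)
    show "x \<otimes> y \<otimes> inv x \<otimes> inv y \<in> D (Suc i)" if "x \<in> D i" "y \<in> D i" for i x y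
      using that unfolding D_def by (auto simp: derived_def intro!: generate.incl)
  qed (rule D(1))
qed

end

lemma (in group_hom) preimage_subgroup:
  assumes "subgroup K H" shows "subgroup {x \<in> carrier G. h x \<in> K} G"
proof (rule G.subgroupI)
  have "\<one>\<^bsub>G\<^esub> \<in> {x \<in> carrier G. h x \<in> K}"
    using subgroup.one_closed[OF assms] by simp
  then show "{x \<in> carrier G. h x \<in> K} \<noteq> {}" by blast
qed (use assms in \<open>auto simp: subgroup.m_closed subgroup.m_inv_closed\<close>)

lemma (in group_hom) max_condition_image:
  assumes surj: "h ` carrier G = carrier H" and max: "max_condition G (carrier G)"
  shows "max_condition H (carrier H)"
  unfolding max_condition_def
proof (intro allI impI)
  fix f :: "nat \<Rightarrow> 'c set"
  assume f: "\<forall>i. subgroup (f i) H \<and> f i \<subseteq> carrier H \<and> f i \<subseteq> f (Suc i)"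
  let ?F = "\<lambda>i. {x \<in> carrier G. h x \<in> f i}"
  have "\<forall>i. subgroup (?F i) G \<and> ?F i \<subseteq> carrier G \<and> ?F i \<subseteq> ?F (Suc i)"
    using f preimage_subgroup by (auto simp: subset_iff)
  then obtain m where m: "\<forall>i\<ge>m. ?F i = ?F m"
    using max[unfolded max_condition_def, rule_format, of ?F] by blast
  have img: "h ` ?F i = f i" for i
  proof -
    have "f i \<subseteq> h ` carrier G" using f surj by simp
    then show ?thesis by blast
  qed
  have "f i = f m" if "i \<ge> m" for i
    using m[rule_format, OF that] img[of i] img[of m] by argo
  then show "\<exists>m. \<forall>i\<ge>m. f i = f m" by blast
qed

section \<open>Counting modulo powers in an abelian group\<close>

text \<open>A finite set of elements that are pairwise incongruent modulo \<open>q\<close>-th powers.  The size of such a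
  set is a lower bound for the order of the quotient by the \<open>q\<close>-th powers, and it makes sense
  without knowing that the quotient is finite.\<close>

definition separated_mod_powers :: "('a, 'b) monoid_scheme \<Rightarrow> nat \<Rightarrow> 'a set \<Rightarrow> bool"
  where "separated_mod_powers G q V \<longleftrightarrow> finite V \<and> V \<subseteq> carrier G \<and>
    (\<forall>x\<in>V. \<forall>y\<in>V. \<forall>a\<in>carrier G. x \<otimes>\<^bsub>G\<^esub> inv\<^bsub>G\<^esub> y = a [^]\<^bsub>G\<^esub> q \<longrightarrow> x = y)"

lemma (in group) mem_adjoin_iff:
  assumes "a \<in> carrier G"
  shows "g \<in> K <#> generate G {a} \<longleftrightarrow> (\<exists>k\<in>K. \<exists>i::int. g = k \<otimes> a [^] i)"
  unfolding set_mult_def generate_pow[OF assms] by blast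

context comm_group
begin

lemma adjoin_subgroup:
  assumes K: "subgroup K G" and a: "a \<in> carrier G"
  shows "subgroup (K <#> generate G {a}) G" "K \<subseteq> K <#> generate G {a}" "a \<in> K <#> generate G {a}"
proof -
  have gen: "subgroup (generate G {a}) G" using a by (simp add: generate_is_subgroup)
  have "K \<lhd> G" using K normal_iff_subgroup by blast
  then show "subgroup (K <#> generate G {a}) G"
    using mult_norm_subgroup gen by blast
  have "k \<in> K <#> generate G {a}" if "k \<in> K" for k
    unfolding mem_adjoin_iff[OF a] using that subgroup.mem_carrier[OF K that]
    by (intro bexI[of _ k] exI[of _ 0]) simp_all
  then show "K \<subseteq> K <#> generate G {a}" by blast
  show "a \<in> K <#> generate G {a}"
    unfolding mem_adjoin_iff[OF a] using a subgroup.one_closed[OF K]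
    by (intro bexI[of _ \<one>] exI[of _ 1]) simp_all
qed

text \<open>This is the finiteness of finitely generated abelian torsion groups, applied to \<open>G / D\<close>.  A
  maximal subgroup among those in which \<open>D\<close> has finite index must be everything, since adjoining an
  element, some power of which already lies in the subgroup, enlarges it by a finite index only.\<close>

lemma finitely_many_cosets_if_power_in:
  assumes max: "max_condition G (carrier G)" and D: "subgroup D G"
    and pow: "\<And>a. a \<in> carrier G \<Longrightarrow> \<exists>n::nat>0. a [^] n \<in> D"
  shows "finitely_many_cosets G D (carrier G)"
proof -
  define P where "P B \<longleftrightarrow> subgroup B G \<and> D \<subseteq> B \<and> finitely_many_cosets G D B" for B
  have DG: "D \<subseteq> carrier G" using D by (simp add: subgroup.subset)
  have "P D" unfolding P_def using D finitely_many_cosets_refl[OF DG] by blast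
  then obtain M where M: "P M" "\<And>L. P L \<Longrightarrow> M \<subseteq> L \<Longrightarrow> L = M"
    using max_condition_maximal[OF max, of P] unfolding P_def by blast
  have sM: "subgroup M G" and DM: "D \<subseteq> M" using M(1) unfolding P_def by auto
  have "a \<in> M" if a: "a \<in> carrier G" for a
  proof -
    let ?L = "M <#> generate G {a}"
    note L = adjoin_subgroup[OF sM a]
    obtain n :: nat where n: "n > 0" "a [^] n \<in> D" using pow a by blast
    have "\<exists>k\<in>M. \<exists>r\<in>(\<lambda>i::nat. a [^] i) ` {..<n}. g = k \<otimes> r" if g: "g \<in> ?L" for g
    proof -
      obtain k i where ki: "k \<in> M" "g = k \<otimes> a [^] (i::int)"
        using g[unfolded mem_adjoin_iff[OF a]] by blast
      have kG: "k \<in> carrier G" using ki sM by (simp add: subgroup.mem_carrier)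
      have "a [^] i = (a [^] n) [^] (i div int n) \<otimes> a [^] nat (i mod int n)"
        using a n(1) by (simp flip: int_pow_int int_pow_mult add: int_pow_pow)
      moreover have "(a [^] n) [^] (i div int n) \<in> M"
        using n(2) DM subgroup_int_pow_closed[OF sM] by blast
      moreover have "nat (i mod int n) < n" using n(1) by (simp add: nat_less_iff)
      ultimately have "g = (k \<otimes> (a [^] n) [^] (i div int n)) \<otimes> a [^] nat (i mod int n)"
        "k \<otimes> (a [^] n) [^] (i div int n) \<in> M" "nat (i mod int n) \<in> {..<n}"
        using ki kG a subgroup.m_closed[OF sM] by (simp_all add: m_assoc)
      then show ?thesis by blast
    qed
    then have "finitely_many_cosets G M ?L"
      unfolding finitely_many_cosets_def using a
      by (intro exI[of _ "(\<lambda>i::nat. a [^] i) ` {..<n}"]) auto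
    then have "finitely_many_cosets G D ?L"
      using finitely_many_cosets_trans[OF DG, of M ?L] M(1) unfolding P_def by blast
    then have "P ?L" unfolding P_def using L DM by blast
    then show ?thesis using M(2)[of ?L] L by blast
  qed
  then have "carrier G \<subseteq> M" by blast
  then show ?thesis using M(1) finitely_many_cosets_mono unfolding P_def by blast
qed

text \<open>The product of exponents that work for the finitely many coset representatives works for all
  elements.\<close>

lemma uniform_exponent:
  assumes D: "subgroup D G" and fin: "finitely_many_cosets G D (carrier G)"
  obtains N :: nat where "N > 0" "\<And>a. a \<in> carrier G \<Longrightarrow> a [^] N \<in> D"
proof -
  obtain R where R: "finite R" "R \<subseteq> carrier G"
    "\<And>g. g \<in> carrier G \<Longrightarrow> \<exists>k\<in>D. \<exists>r\<in>R. g = k \<otimes> r"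
    using fin unfolding finitely_many_cosets_def by blast
  have "\<exists>s::nat>0. r [^] s \<in> D" if "r \<in> R" for r
    using power_in_finite_index_subgroup[OF D fin subgroup_self, of r] that R(2) by (metis subsetD)
  then obtain s :: "'a \<Rightarrow> nat" where s: "\<And>r. r \<in> R \<Longrightarrow> s r > 0 \<and> r [^] s r \<in> D" by metis
  define N where "N = prod s R"
  have "a [^] N \<in> D" if a: "a \<in> carrier G" for a
  proof -
    obtain k r where kr: "k \<in> D" "r \<in> R" "a = k \<otimes> r" using R(3) a by blast
    obtain j where j: "N = s r * j" unfolding N_def using R(1) kr(2) by (meson dvdE dvd_prodI)
    have c: "k \<in> carrier G" "r \<in> carrier G" using kr R(2) D by (auto simp: subgroup.mem_carrier)
    have "a [^] N = k [^] N \<otimes> (r [^] s r) [^] j"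
      unfolding kr(3) using c by (simp add: nat_pow_distrib nat_pow_pow j)
    moreover have "x [^] n \<in> D" if "x \<in> D" for x and n :: nat
      using subgroup_int_pow_closed[OF D that, of "int n"] by (simp add: int_pow_int)
    ultimately show ?thesis using s[OF kr(2)] kr(1) D by (simp add: subgroup.m_closed)
  qed
  moreover have "N > 0" unfolding N_def using s by (simp add: prod_pos)
  ultimately show thesis using that by blast
qed

text \<open>The hypothesis says that squaring is surjective on \<open>G / \<langle>x\<rangle>\<close>.  If some element had infinite order
  modulo \<open>\<langle>x\<rangle>\<close>, then repeatedly taking square roots would produce an ascending chain of subgroups
  \<open>\<langle>x, d\<rangle>\<close>.  When the chain stops, a square root \<open>d\<close> of \<open>b\<close> is itself a power of \<open>b\<close> modulo
  \<open>\<langle>x\<rangle>\<close>, so that \<open>d = d\<^sup>2\<^sup>m\<close> there, and the odd exponent \<open>1 - 2 m\<close> cannot vanish.\<close>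

lemma power_in_cyclic_if_generates_mod_squares:
  assumes max: "max_condition G (carrier G)" and x: "x \<in> carrier G"
    and gen: "\<And>a. a \<in> carrier G \<Longrightarrow> \<exists>b\<in>carrier G. \<exists>j::int. a = b [^] (2::int) \<otimes> x [^] j"
    and a: "a \<in> carrier G"
  shows "\<exists>n::nat>0. a [^] n \<in> generate G {x}"
proof -
  let ?X = "generate G {x}"
  have V: "subgroup ?X G" using x by (simp add: generate_is_subgroup)
  define T where "T = {a \<in> carrier G. \<exists>n::int. n \<noteq> 0 \<and> a [^] n \<in> ?X}"
  have xX: "x [^] (i::int) \<in> ?X" for i unfolding generate_pow[OF x] by blast
  have "a \<in> T"
  proof (rule ccontr)
    assume "a \<notin> T"
    define P where "P K \<longleftrightarrow> (\<exists>b\<in>carrier G - T. K = ?X <#> generate G {b})" for K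
    have "P (?X <#> generate G {a})" unfolding P_def using a \<open>a \<notin> T\<close> by blast
    then obtain M where M: "P M" "\<And>L. P L \<Longrightarrow> M \<subseteq> L \<Longrightarrow> L = M"
      using max_condition_maximal[OF max, of P] adjoin_subgroup(1)[OF V] unfolding P_def by blast
    obtain b where b: "b \<in> carrier G" "b \<notin> T" "M = ?X <#> generate G {b}"
      using M(1) unfolding P_def by blast
    obtain d j where d: "d \<in> carrier G" "b = d [^] (2::int) \<otimes> x [^] (j::int)"
      using gen b(1) by blast
    let ?L = "?X <#> generate G {d}"
    have "d \<notin> T"
    proof
      assume "d \<in> T"
      then obtain n :: int where n: "n \<noteq> 0" "d [^] n \<in> ?X" unfolding T_def by blast
      have "b [^] n = (d [^] n) [^] (2::int) \<otimes> (x [^] j) [^] n"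
        unfolding d(2) using d(1) x by (simp add: int_pow_distrib int_pow_pow mult.commute)
      also have "\<dots> \<in> ?X"
        using n(2) xX V subgroup_int_pow_closed[OF V] by (intro subgroup.m_closed) blast+
      finally show False using b n(1) unfolding T_def by blast
    qed
    then have PL: "P ?L" unfolding P_def using d(1) by blast
    have sL: "subgroup ?L G" and XL: "?X \<subseteq> ?L" and dL: "d \<in> ?L"
      using adjoin_subgroup[OF V d(1)] by auto
    have bL: "b \<in> ?L"
      unfolding d(2) using sL XL xX dL subgroup_int_pow_closed[OF sL]
      by (intro subgroup.m_closed) blast+
    have "M \<subseteq> ?L"
    proof
      fix g assume "g \<in> M"
      then obtain k i where ki: "k \<in> ?X" "g = k \<otimes> b [^] (i::int)"
        unfolding b(3) mem_adjoin_iff[OF b(1)] by blast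
      have "k \<in> ?L" using ki(1) XL by blast
      then show "g \<in> ?L"
        unfolding ki(2) by (intro subgroup.m_closed[OF sL] subgroup_int_pow_closed[OF sL bL])
    qed
    then have "d \<in> M" using M(2)[OF PL] dL by simp
    then obtain k m where k: "k \<in> ?X" "d = k \<otimes> b [^] (m::int)"
      unfolding b(3) mem_adjoin_iff[OF b(1)] by blast
    have kG: "k \<in> carrier G" using k V by (simp add: subgroup.mem_carrier)
    have "d = k \<otimes> (d [^] (2 * m) \<otimes> x [^] (j * m))"
      using k(2) d x by (simp add: int_pow_distrib int_pow_pow)
    then have "d = d [^] (2 * m) \<otimes> (k \<otimes> x [^] (j * m))"
      using d kG x by (simp add: m_lcomm)
    then have "inv (d [^] (2 * m)) \<otimes> d = k \<otimes> x [^] (j * m)"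
      using d kG x inv_solve_left'[of "k \<otimes> x [^] (j * m)" "d [^] (2 * m)" d] by simp
    moreover have "inv (d [^] (2 * m)) \<otimes> d = d [^] (1 - 2 * m)"
      using d int_pow_diff[of d 1 "2 * m"] by (simp add: m_comm)
    moreover have "k \<otimes> x [^] (j * m) \<in> ?X"
      by (rule subgroup.m_closed[OF V k(1) xX])
    ultimately have "d [^] (1 - 2 * m) \<in> ?X" by argo
    moreover have "1 - 2 * m \<noteq> 0" by presburger
    ultimately show False using \<open>d \<notin> T\<close> d(1) unfolding T_def by blast
  qed
  then obtain n :: int where n: "n \<noteq> 0" "a [^] n \<in> ?X" unfolding T_def by blast
  have "a [^] (- n) \<in> ?X"
    using n(2) a V by (simp add: int_pow_neg subgroup.m_inv_closed)
  then have "a [^] \<bar>n\<bar> \<in> ?X" using n(2) by (simp add: abs_if)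
  then have "a [^] nat \<bar>n\<bar> \<in> ?X" by (simp flip: int_pow_int)
  then show ?thesis using n(1) by (intro exI[of _ "nat \<bar>n\<bar>"]) simp
qed

lemma inv_not_square:
  assumes x: "x \<in> carrier G" "\<And>b. b \<in> carrier G \<Longrightarrow> x \<noteq> b [^] (2::nat)" and a: "a \<in> carrier G"
  shows "inv x \<noteq> a [^] (2::nat)"
proof
  assume "inv x = a [^] (2::nat)"
  then have "x = inv a [^] (2::nat)" using x(1) a inv_inv[of x] by (simp add: nat_pow_inv)
  then show False using x(2) a by blast
qed

text \<open>If every element were a square, then every element would be torsion, by
  \<open>power_in_cyclic_if_generates_mod_squares\<close> with the trivial cyclic subgroup.  So the neutral element and a non-square are incongruent.\<close>

lemma separated_pair:
  assumes max: "max_condition G (carrier G)" and nontriv: "carrier G \<noteq> {\<one>}"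
    and tf: "\<And>a n. a \<in> carrier G \<Longrightarrow> n > (0::nat) \<Longrightarrow> a [^] n = \<one> \<Longrightarrow> a = \<one>"
  obtains V where "separated_mod_powers G 2 V" "card V = 2"
proof -
  obtain a where a: "a \<in> carrier G" "a \<noteq> \<one>" using nontriv one_closed by blast
  have "\<exists>x\<in>carrier G. \<forall>b\<in>carrier G. x \<noteq> b [^] (2::nat)"
  proof (rule ccontr)
    assume "\<not> ?thesis"
    then have sq: "\<exists>b\<in>carrier G. x = b [^] (2::nat)" if "x \<in> carrier G" for x using that by blast
    have "\<exists>b\<in>carrier G. \<exists>j::int. x = b [^] (2::int) \<otimes> \<one> [^] j" if "x \<in> carrier G" for x
      using sq[OF that] int_pow_int[of G _ 2] by auto
    then have "\<exists>n::nat>0. a [^] n \<in> generate G {\<one>}"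
      using power_in_cyclic_if_generates_mod_squares[OF max one_closed _ a(1)] by blast
    then show False using tf a generate_one by auto
  qed
  then obtain x where x: "x \<in> carrier G" "\<And>b. b \<in> carrier G \<Longrightarrow> x \<noteq> b [^] (2::nat)" by blast
  have x1: "x \<noteq> \<one>" using x(2)[of \<one>] by auto
  have "separated_mod_powers G 2 {\<one>, x}"
    unfolding separated_mod_powers_def using x inv_not_square[OF x] by auto
  then show thesis using that[of "{\<one>, x}"] x1 by simp
qed

text \<open>If there are no three incongruent elements, then one element \<open>x\<close> (a non-square, if there is one)
  generates the group modulo squares.\<close>

lemma separated_triple_or_power_in_cyclic:
  assumes max: "max_condition G (carrier G)"
  obtains (triple) V where "separated_mod_powers G 2 V" "card V = 3"
  | (cyclic) x where "x \<in> carrier G" "\<And>a. a \<in> carrier G \<Longrightarrow> \<exists>n::nat>0. a [^] n \<in> generate G {x}"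
proof -
  have "\<exists>x\<in>carrier G. \<forall>a\<in>carrier G. \<exists>b\<in>carrier G. \<exists>j::int. a = b [^] (2::int) \<otimes> x [^] j"
    if no: "\<And>V. separated_mod_powers G 2 V \<Longrightarrow> card V \<noteq> 3"
  proof (cases "\<exists>x\<in>carrier G. \<forall>b\<in>carrier G. x \<noteq> b [^] (2::nat)")
    case False
    then have "\<forall>a\<in>carrier G. \<exists>b\<in>carrier G. \<exists>j::int. a = b [^] (2::int) \<otimes> \<one> [^] j"
      using int_pow_int[of G _ 2] by auto
    then show ?thesis by blast
  next
    case True
    then obtain x where x: "x \<in> carrier G" "\<And>b. b \<in> carrier G \<Longrightarrow> x \<noteq> b [^] (2::nat)" by blast
    have "\<exists>b\<in>carrier G. \<exists>j::int. a = b [^] (2::int) \<otimes> x [^] j" if a: "a \<in> carrier G" for a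
    proof (rule ccontr)
      assume con: "\<not> ?thesis"
      have c0: "a \<noteq> b [^] (2::nat)" if "b \<in> carrier G" for b
        using con that int_pow_int[of G b 2] by (auto dest!: bspec[OF _ that] spec[of _ "0::int"])
      have c1: "a \<otimes> inv x \<noteq> b [^] (2::nat)" if b: "b \<in> carrier G" for b
      proof
        assume "a \<otimes> inv x = b [^] (2::nat)"
        then have "a = b [^] (2::int) \<otimes> x [^] (1::int)"
          using a b x int_pow_int[of G b 2] inv_solve_right[of "b [^] (2::nat)" a x] by simp
        then show False using con b by blast
      qed
      have c2: "x \<otimes> inv a \<noteq> b [^] (2::nat)" if b: "b \<in> carrier G" for b
      proof
        assume "x \<otimes> inv a = b [^] (2::nat)"
        then have "inv (x \<otimes> inv a) = inv b [^] (2::nat)" using b by (simp add: nat_pow_inv)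
        then have "a \<otimes> inv x = inv b [^] (2::nat)" using a x by (simp add: inv_mult_group)
        then show False using c1 b by blast
      qed
      have x1: "x \<noteq> \<one>" using x(2)[of \<one>] by auto
      have a1: "a \<noteq> \<one>" using c0[of \<one>] by auto
      have ax: "a \<noteq> x" using c1[of \<one>] x by auto
      have "separated_mod_powers G 2 {\<one>, x, a}"
        unfolding separated_mod_powers_def
        using a x c0 c1 c2 inv_not_square[OF x] inv_not_square[OF a c0] by auto
      then show False using no[of "{\<one>, x, a}"] x1 a1 ax by auto
    qed
    then show ?thesis using x(1) by blast
  qed
  then show thesis
    using triple cyclic power_in_cyclic_if_generates_mod_squares[OF max] by metis
qed

text \<open>In a torsion-free abelian group squaring is injective, so the products \<open>v y\<^sup>2\<close>, with \<open>v\<close> taken from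
  a separated set modulo squares and \<open>y\<close> from one modulo \<open>2\<^sup>e\<close>-th powers, are incongruent modulo
  powers of exponent \<open>2\<^sup>e\<^sup>+\<^sup>1\<close>: first \<open>v\<close> is determined modulo squares, then \<open>y\<close> by extracting a
  square root.\<close>

lemma separated_iterate:
  assumes tf: "\<And>a n. a \<in> carrier G \<Longrightarrow> n > (0::nat) \<Longrightarrow> a [^] n = \<one> \<Longrightarrow> a = \<one>"
    and V: "separated_mod_powers G 2 V"
  obtains Y where "separated_mod_powers G (2 ^ e) Y" "card Y = card V ^ e"
proof -
  have XG: "V \<subseteq> carrier G" using V unfolding separated_mod_powers_def by blast
  have "\<exists>Y. separated_mod_powers G (2 ^ e) Y \<and> card Y = card V ^ e"
  proof (induction e)
    case 0
    show ?case by (intro exI[of _ "{\<one>}"]) (simp add: separated_mod_powers_def)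
  next
    case (Suc e)
    then obtain Y where Y: "separated_mod_powers G (2 ^ e) Y" "card Y = card V ^ e" by blast
    have YG: "Y \<subseteq> carrier G" using Y unfolding separated_mod_powers_def by blast
    define f where "f = (\<lambda>(x, y). x \<otimes> y [^] (2::nat))"
    have sep: "x = x' \<and> y = y'"
      if m: "x \<in> V" "x' \<in> V" "y \<in> Y" "y' \<in> Y" and z: "z \<in> carrier G"
        and eq: "f (x, y) \<otimes> inv (f (x', y')) = z [^] (2 ^ Suc e :: nat)" for x y x' y' z
    proof -
      have c: "x \<in> carrier G" "x' \<in> carrier G" "y \<in> carrier G" "y' \<in> carrier G"
        using m XG YG by auto
      define w where "w = z [^] (2 ^ e :: nat)"
      have w: "w \<in> carrier G" unfolding w_def using z by simp
      define u where "u = y \<otimes> inv y'"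
      have u: "u \<in> carrier G" unfolding u_def using c by simp
      have "f (x, y) \<otimes> inv (f (x', y')) = (x \<otimes> inv x') \<otimes> u [^] (2::nat)"
        unfolding f_def u_def using c
        by (simp add: inv_mult_group nat_pow_distrib nat_pow_inv m_ac)
      moreover have "z [^] (2 ^ Suc e :: nat) = w [^] (2::nat)"
        unfolding w_def using z by (simp add: nat_pow_pow mult.commute)
      ultimately have e1: "(x \<otimes> inv x') \<otimes> u [^] (2::nat) = w [^] (2::nat)" using eq by simp
      then have "x \<otimes> inv x' = w [^] (2::nat) \<otimes> inv (u [^] (2::nat))"
        using c u w inv_solve_right[of "x \<otimes> inv x'" "w [^] (2::nat)" "u [^] (2::nat)"] by simp
      also have "\<dots> = (w \<otimes> inv u) [^] (2::nat)"
        using u w by (simp add: nat_pow_distrib nat_pow_inv)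
      finally have xx: "x = x'"
        using V m(1,2) u w unfolding separated_mod_powers_def by blast
      then have "u [^] (2::nat) = w [^] (2::nat)" using e1 c u by simp
      then have "(u \<otimes> inv w) [^] (2::nat) = \<one>"
        using u w by (simp add: nat_pow_distrib nat_pow_inv)
      then have "u \<otimes> inv w = \<one>" using tf[of "u \<otimes> inv w" 2] u w by simp
      then have "u = w" using u w inv_solve_right[of \<one> u w] by simp
      then have "y = y'"
        using Y m(3,4) z unfolding separated_mod_powers_def u_def w_def by blast
      then show ?thesis using xx by blast
    qed
    have fG: "f p \<in> carrier G" if "p \<in> V \<times> Y" for p
      using that XG YG unfolding f_def by auto
    have inj: "inj_on f (V \<times> Y)"
    proof (rule inj_onI)
      fix p p' assume p: "p \<in> V \<times> Y" "p' \<in> V \<times> Y" "f p = f p'"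
      obtain x y x' y' where [simp]: "p = (x, y)" "p' = (x', y')" by (cases p, cases p')
      have "f (x, y) \<otimes> inv (f (x', y')) = \<one> [^] (2 ^ Suc e :: nat)"
        using p fG[of p'] by simp
      then show "p = p'" using sep[of x x' y y' \<one>] p by simp
    qed
    have "separated_mod_powers G (2 ^ Suc e) (f ` (V \<times> Y))"
      unfolding separated_mod_powers_def
    proof (intro conjI ballI impI)
      show "finite (f ` (V \<times> Y))"
        using V Y(1) unfolding separated_mod_powers_def by simp
      show "f ` (V \<times> Y) \<subseteq> carrier G" using fG by blast
    next
      fix g g' a
      assume g: "g \<in> f ` (V \<times> Y)" "g' \<in> f ` (V \<times> Y)" "a \<in> carrier G"
        "g \<otimes> inv g' = a [^] (2 ^ Suc e :: nat)"
      then obtain x y x' y' where "g = f (x, y)" "g' = f (x', y')" "x \<in> V" "y \<in> Y" "x' \<in> V" "y' \<in> Y"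
        by blast
      then show "g = g'" using sep[of x x' y y' a] g by blast
    qed
    moreover have "card (f ` (V \<times> Y)) = card V ^ Suc e"
      using card_image[OF inj] Y(2) by (simp add: card_cartesian_product)
    ultimately show ?case by blast
  qed
  then show thesis using that by blast
qed

end

section \<open>Conjugation on a normal abelian subgroup modulo powers\<close>

text \<open>Both elements have a nontrivial power in a common infinite cyclic group.\<close>

lemma (in group) vc_subgroup_commensurable:
  assumes vc: "vc_subgroup G H" and y: "y \<in> H" and z: "z \<in> H"
    and iy: "\<And>n::int. y [^] n = \<one> \<Longrightarrow> n = 0" and iz: "\<And>n::int. z [^] n = \<one> \<Longrightarrow> n = 0"
  obtains i j :: int where "i \<noteq> 0" "y [^] i = z [^] j"
proof -
  obtain c where H: "subgroup H G" and c: "c \<in> H" "finitely_many_cosets G (generate G {c}) H"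
    using vc unfolding vc_subgroup_def by blast
  have G: "c \<in> carrier G" "y \<in> carrier G" "z \<in> carrier G"
    using H c y z by (auto simp: subgroup.mem_carrier)
  have gen: "subgroup (generate G {c}) G" using G by (simp add: generate_is_subgroup)
  obtain s :: nat where s: "s > 0" "y [^] s \<in> generate G {c}"
    using power_in_finite_index_subgroup[OF gen c(2) H y] by blast
  obtain s' :: nat where s': "s' > 0" "z [^] s' \<in> generate G {c}"
    using power_in_finite_index_subgroup[OF gen c(2) H z] by blast
  obtain m n :: int where mn: "y [^] s = c [^] m" "z [^] s' = c [^] n"
    using s s' unfolding generate_pow[OF G(1)] by blast
  have "y [^] (int s * n) = c [^] (m * n)"
    using mn(1) G by (simp add: int_pow_int flip: int_pow_pow)
  also have "\<dots> = (c [^] n) [^] m"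
    using G by (simp add: int_pow_pow mult.commute)
  also have "\<dots> = z [^] (int s' * m)"
    using G by (simp add: int_pow_int flip: mn(2) int_pow_pow)
  finally have eq: "y [^] (int s * n) = z [^] (int s' * m)" .
  have "n \<noteq> 0"
  proof
    assume "n = 0"
    then have "z [^] int s' = \<one>" using mn(2) by (simp add: int_pow_int)
    then show False using iz s'(1) by fastforce
  qed
  then show thesis using that[OF _ eq] s(1) by simp
qed

locale normal_abelian_subgroup = group G for G (structure) +
  fixes A
  assumes normal: "A \<lhd> G" and commute: "\<And>a b. a \<in> A \<Longrightarrow> b \<in> A \<Longrightarrow> a \<otimes> b = b \<otimes> a"
begin

lemma subgroup_A: "subgroup A G" using normal by (rule normal_imp_subgroup)

lemma A_carrier [simp, intro]: "a \<in> A \<Longrightarrow> a \<in> carrier G"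
  using subgroup_A by (simp add: subgroup.mem_carrier)

lemma A_closed [simp, intro]:
  "a \<in> A \<Longrightarrow> b \<in> A \<Longrightarrow> a \<otimes> b \<in> A" "a \<in> A \<Longrightarrow> inv a \<in> A" "\<one> \<in> A"
  "a \<in> A \<Longrightarrow> a [^] (i::int) \<in> A" "a \<in> A \<Longrightarrow> a [^] (n::nat) \<in> A"
  "g \<in> carrier G \<Longrightarrow> a \<in> A \<Longrightarrow> conjugate G g a \<in> A"
  using subgroup_A subgroup_int_pow_closed[OF subgroup_A, of a "int n"]
  by (simp_all add: subgroup.m_closed subgroup.m_inv_closed subgroup.one_closed
      subgroup_int_pow_closed int_pow_int normal_conjugate_closed[OF normal])

lemma comm_group_A: "comm_group (G\<lparr>carrier := A\<rparr>)"
proof -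
  interpret A: group "G\<lparr>carrier := A\<rparr>" using subgroup_A by (rule subgroup_imp_group)
  show ?thesis by (rule A.group_comm_groupI) (simp add: commute)
qed

lemma lcommute: "a \<in> A \<Longrightarrow> b \<in> A \<Longrightarrow> c \<in> A \<Longrightarrow> a \<otimes> (b \<otimes> c) = b \<otimes> (a \<otimes> c)"
  by (metis commute m_assoc A_carrier)

lemma power_mult: "a \<in> A \<Longrightarrow> b \<in> A \<Longrightarrow> (a \<otimes> b) [^] (n::nat) = a [^] n \<otimes> b [^] n"
  by (simp add: pow_mult_distrib commute)

definition powers :: "nat \<Rightarrow> 'a set"
  where "powers q = (\<lambda>a. a [^] q) ` A"

lemma powers_subset: "powers q \<subseteq> A"
  unfolding powers_def by auto

lemma powers_carrier: "x \<in> powers q \<Longrightarrow> x \<in> carrier G"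
  using powers_subset by blast

lemma powers_subgroup: "subgroup (powers q) G"
proof (rule subgroupI)
  show "powers q \<subseteq> carrier G" using powers_carrier by blast
  show "powers q \<noteq> {}" unfolding powers_def using A_closed(3) by blast
next
  fix x assume "x \<in> powers q"
  then obtain a where "a \<in> A" "x = a [^] q" unfolding powers_def by blast
  then have "inv x = inv a [^] q" "inv a \<in> A" by (simp_all add: nat_pow_inv)
  then show "inv x \<in> powers q" unfolding powers_def by blast
next
  fix x y assume "x \<in> powers q" "y \<in> powers q"
  then obtain a b where "a \<in> A" "x = a [^] q" "b \<in> A" "y = b [^] q" unfolding powers_def by blast
  then have "x \<otimes> y = (a \<otimes> b) [^] q" "a \<otimes> b \<in> A" by (simp_all add: power_mult)
  then show "x \<otimes> y \<in> powers q" unfolding powers_def by blast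
qed

lemma powers_normal: "powers q \<lhd> G"
proof (rule normalI_conjugate[OF powers_subgroup])
  fix g x assume g: "g \<in> carrier G" and "x \<in> powers q"
  then obtain a where "a \<in> A" "x = a [^] q" unfolding powers_def by blast
  then have "conjugate G g x = conjugate G g a [^] q" "conjugate G g a \<in> A"
    using g by (simp_all add: conjugate_nat_pow)
  then show "conjugate G g x \<in> powers q" unfolding powers_def by blast
qed

lemma powers_closed:
  "x \<in> powers q \<Longrightarrow> y \<in> powers q \<Longrightarrow> x \<otimes> y \<in> powers q"
  "x \<in> powers q \<Longrightarrow> inv x \<in> powers q"
  "g \<in> carrier G \<Longrightarrow> x \<in> powers q \<Longrightarrow> conjugate G g x \<in> powers q"
  using powers_subgroup normal_conjugate_closed[OF powers_normal]
  by (simp_all add: subgroup.m_closed subgroup.m_inv_closed)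

lemma separated_subset:
  "separated_mod_powers (G\<lparr>carrier := A\<rparr>) q S \<Longrightarrow> finite S \<and> S \<subseteq> A"
  unfolding separated_mod_powers_def by simp

lemma separatedD:
  assumes "separated_mod_powers (G\<lparr>carrier := A\<rparr>) q S" "x \<in> S" "y \<in> S" "x \<otimes> inv y \<in> powers q"
  shows "x = y"
proof -
  have "y \<in> A" using separated_subset[OF assms(1)] assms(3) by blast
  then have "inv\<^bsub>G\<lparr>carrier := A\<rparr>\<^esub> y = inv y" using subgroup_A by simp
  moreover obtain a where "a \<in> A" "x \<otimes> inv y = a [^]\<^bsub>G\<lparr>carrier := A\<rparr>\<^esub> q"
    using assms(4) nat_pow_consistent unfolding powers_def by force
  ultimately show ?thesis
    using assms(1)[unfolded separated_mod_powers_def, THEN conjunct2, THEN conjunct2,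
        rule_format, OF assms(2,3), of a] by simp
qed

text \<open>Conjugation by \<open>s\<close> induces the identity on the quotient of \<open>A\<close> by its \<open>q\<close>-th powers.\<close>

definition acts_trivially_mod :: "nat \<Rightarrow> 'a \<Rightarrow> bool"
  where "acts_trivially_mod q s \<longleftrightarrow> (\<forall>a\<in>A. conjugate G s a \<otimes> inv a \<in> powers q)"

text \<open>In additive notation, let \<open>s\<close> act on \<open>A\<close> as \<open>1 + q W\<close>, with a not necessarily additive map
  \<open>W\<close>.  Then \<open>s\<^sup>2\<close> acts as \<open>1 + 2 q W + q\<^sup>2 W\<^sup>2\<close>, and \<open>q\<^sup>2\<close> is divisible by \<open>2 q\<close> when \<open>q\<close> is even.\<close>

lemma acts_trivially_mod_square:
  assumes s: "s \<in> carrier G" and triv: "acts_trivially_mod q s" and q: "even q"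
  shows "acts_trivially_mod (2 * q) (s \<otimes> s)"
  unfolding acts_trivially_mod_def
proof
  fix a assume a: "a \<in> A"
  have dev: "\<exists>w\<in>A. conjugate G s b = w [^] q \<otimes> b" if b: "b \<in> A" for b
  proof -
    obtain w where w: "w \<in> A" "conjugate G s b \<otimes> inv b = w [^] q"
      using triv b unfolding acts_trivially_mod_def powers_def by blast
    then have "conjugate G s b = w [^] q \<otimes> b"
      using b s inv_solve_right[of "w [^] q" "conjugate G s b" b] by simp
    then show ?thesis using w by blast
  qed
  obtain v where v: "v \<in> A" "conjugate G s a = v [^] q \<otimes> a" using dev[OF a] by blast
  obtain u where u: "u \<in> A" "conjugate G s v = u [^] q \<otimes> v" using dev[OF v(1)] by blast
  obtain p where p: "q = 2 * p" using q by (rule evenE)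
  have "conjugate G (s \<otimes> s) a = conjugate G s v [^] q \<otimes> (v [^] q \<otimes> a)"
    using s a v by (simp add: conjugate_mult conjugate_nat_pow flip: conjugate_conjugate)
  also have "conjugate G s v [^] q = (u [^] p) [^] (2 * q) \<otimes> v [^] q"
    using u v(1) by (simp add: power_mult nat_pow_pow p mult.assoc mult.commute)
  finally have "conjugate G (s \<otimes> s) a \<otimes> inv a = (u [^] p) [^] (2 * q) \<otimes> (v [^] q \<otimes> v [^] q)"
    using u v a by (simp add: m_assoc)
  also have "v [^] q \<otimes> v [^] q = v [^] (2 * q)"
    using v(1) by (simp add: nat_pow_mult mult_2)
  also have "(u [^] p) [^] (2 * q) \<otimes> v [^] (2 * q) = (u [^] p \<otimes> v) [^] (2 * q)"
    using u v by (simp add: power_mult)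
  finally show "conjugate G (s \<otimes> s) a \<otimes> inv a \<in> powers (2 * q)"
    unfolding powers_def using u v by blast
qed

text \<open>The quotient of \<open>A\<close> by its squares is finite, so two powers of \<open>t\<close> permute it in the same way.
  The permutations are compared through a choice \<open>\<rho>\<close> of coset representatives.\<close>

lemma acts_trivially_mod_two:
  assumes fin: "finitely_many_cosets G (powers 2) A" and t: "t \<in> carrier G"
  obtains k :: nat where "k > 0" "acts_trivially_mod 2 (t [^] k)"
proof -
  obtain R where R: "finite R" "R \<subseteq> carrier G"
    "\<And>a. a \<in> A \<Longrightarrow> \<exists>p\<in>powers 2. \<exists>r\<in>R. a = p \<otimes> r"
    using fin unfolding finitely_many_cosets_def by blast
  define R' where "R' = R \<inter> A"
  have "\<exists>r. r \<in> R' \<and> a \<otimes> inv r \<in> powers 2" if a: "a \<in> A" for a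
  proof -
    obtain p r where pr: "p \<in> powers 2" "r \<in> R" "a = p \<otimes> r" using R(3) a by blast
    have G: "p \<in> A" "r \<in> carrier G" using pr powers_subset R(2) by auto
    have "r = inv p \<otimes> a" using G pr(3) a by (simp flip: m_assoc)
    then have "r \<in> A" using G a by simp
    moreover have "a \<otimes> inv r = p" using pr(3) G by (simp add: m_assoc)
    ultimately show ?thesis unfolding R'_def using pr by blast
  qed
  then obtain \<rho> where \<rho>: "\<And>a. a \<in> A \<Longrightarrow> \<rho> a \<in> R' \<and> a \<otimes> inv (\<rho> a) \<in> powers 2" by metis
  have R'A: "R' \<subseteq> A" "finite R'" unfolding R'_def using R(1) by auto
  define F where "F u = restrict (\<lambda>r. \<rho> (conjugate G (t [^] u) r)) R'" for u :: nat
  have "F u \<in> R' \<rightarrow>\<^sub>E R'" for u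
    unfolding F_def using \<rho> R'A t by (auto simp: subset_iff)
  then have "finite (range F)"
    using R'A(2) by (meson finite_PiE finite_subset image_subsetI)
  then have "\<not> inj F" using finite_imageD infinite_UNIV_nat by blast
  then obtain u v where uv: "u < v" "F u = F v"
    unfolding inj_on_def by (metis linorder_neqE_nat)
  define s where "s = t [^] (v - u)"
  have s: "s \<in> carrier G" unfolding s_def using t by simp
  have rep: "conjugate G s r \<otimes> inv r \<in> powers 2" if r: "r \<in> R'" for r
  proof -
    let ?u = "conjugate G (t [^] u) r" and ?v = "conjugate G (t [^] v) r"
    have rA: "r \<in> A" using r R'A by blast
    have A: "?u \<in> A" "?v \<in> A" using rA t by simp_all
    have eq: "\<rho> ?u = \<rho> ?v" using fun_cong[OF uv(2), of r] r unfolding F_def by simp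
    have \<rho>A: "\<rho> ?u \<in> A" using \<rho>[OF A(1)] R'A by blast
    have "(?v \<otimes> inv (\<rho> ?u)) \<otimes> inv (?u \<otimes> inv (\<rho> ?u)) \<in> powers 2"
      using \<rho>[OF A(1)] \<rho>[OF A(2)] by (simp add: powers_closed eq)
    also have "(?v \<otimes> inv (\<rho> ?u)) \<otimes> inv (?u \<otimes> inv (\<rho> ?u)) = ?v \<otimes> inv ?u"
      using A \<rho>A by (simp add: inv_mult_group m_assoc)
    finally have "conjugate G (inv (t [^] u)) (?v \<otimes> inv ?u) \<in> powers 2"
      using powers_closed(3) t by simp
    moreover have "t [^] v = t [^] u \<otimes> s"
      unfolding s_def using uv(1) t by (simp add: nat_pow_mult)
    then have "?v = conjugate G (t [^] u) (conjugate G s r)"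
      using t s rA by (simp add: conjugate_conjugate)
    ultimately show ?thesis
      using t s rA by (simp add: conjugate_mult conjugate_inv)
  qed
  have "acts_trivially_mod 2 s"
    unfolding acts_trivially_mod_def
  proof
    fix a assume a: "a \<in> A"
    define r where "r = \<rho> a"
    define p where "p = a \<otimes> inv r"
    have r: "r \<in> R'" "r \<in> A" and p: "p \<in> powers 2" "p \<in> A"
      using \<rho>[OF a] R'A a powers_subset unfolding r_def p_def by auto
    have "a = p \<otimes> r" unfolding p_def using a r by (simp add: m_assoc)
    then have "conjugate G s a \<otimes> inv a = conjugate G s p \<otimes> inv p \<otimes> (conjugate G s r \<otimes> inv r)"
      using s r p by (simp add: conjugate_mult inv_mult_group commute lcommute m_assoc)
    then show "conjugate G s a \<otimes> inv a \<in> powers 2"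
      using rep[OF r(1)] p s powers_closed by simp
  qed
  then show thesis using that[of "v - u"] uv(1) unfolding s_def by simp
qed

lemma acts_trivially_mod_two_powers:
  fixes k :: nat
  assumes t: "t \<in> carrier G" and triv: "acts_trivially_mod 2 (t [^] k)"
  shows "acts_trivially_mod (2 ^ Suc e) (t [^] (k * 2 ^ e))"
proof (induction e)
  case (Suc e)
  have "t [^] (k * 2 ^ e) \<otimes> t [^] (k * 2 ^ e) = t [^] (k * 2 ^ Suc e)"
    using t by (simp add: nat_pow_mult mult_2 distrib_left)
  then show ?case
    using acts_trivially_mod_square[OF _ Suc] t by simp
qed (use triv in simp)

definition torsion_free :: bool
  where "torsion_free \<longleftrightarrow> (\<forall>a\<in>A. \<forall>n::nat. n > 0 \<longrightarrow> a [^] n = \<one> \<longrightarrow> a = \<one>)"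

lemma torsion_freeD:
  "torsion_free \<Longrightarrow> a \<in> A \<Longrightarrow> n > (0::nat) \<Longrightarrow> a [^] n = \<one> \<Longrightarrow> a = \<one>"
  unfolding torsion_free_def by blast

lemma torsion_free_int:
  assumes "torsion_free" "a \<in> A" "a \<noteq> \<one>" "a [^] (i::int) = \<one>"
  shows "i = 0"
  using nat_torsion_if_int_torsion[of a i] assms torsion_freeD by blast

text \<open>The \<open>N\<close>-th powers form a cyclic group invariant under conjugation.  An automorphism of an infinite
  cyclic group is \<open>1\<close> or \<open>-1\<close>, so its square is the identity; as \<open>A\<close> is torsion-free, an element
  fixed after raising to the power \<open>N\<close> is fixed.\<close>

lemma square_acts_trivially_if_virtually_cyclic:
  assumes tf: torsion_free
    and x: "x \<in> A" and N: "N > 0" "powers N \<subseteq> generate G {x}" and t: "t \<in> carrier G"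
  shows "acts_trivially_mod q (t [^] (2::nat))"
proof -
  have x_pow: "\<exists>i::int. p = x [^] i" if "p \<in> powers N" for p
    using N(2) that generate_pow[of x] x by blast
  have xN: "x [^] int N \<in> powers N"
    unfolding powers_def using x by (auto simp: int_pow_int)
  then have ex: "\<exists>m::nat. m > 0 \<and> x [^] int m \<in> powers N" using N(1) by blast
  \<comment> \<open>The element \<open>d\<close> with least positive exponent generates the group of \<open>N\<close>-th powers.\<close>
  define m where "m = (LEAST m::nat. m > 0 \<and> x [^] int m \<in> powers N)"
  have m: "m > 0" "x [^] int m \<in> powers N"
    using LeastI_ex[OF ex] unfolding m_def by auto
  define d where "d = x [^] int m"
  have d: "d \<in> powers N" "d \<in> A" using m powers_subset unfolding d_def by auto
  have d_pow: "\<exists>i::int. p = d [^] i" if p: "p \<in> powers N" for p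
  proof -
    obtain i :: int where i: "p = x [^] i" using x_pow p by blast
    have "x [^] (i mod int m) = p \<otimes> d [^] (- (i div int m))"
      unfolding i d_def using x
      by (simp add: int_pow_pow minus_mult_div_eq_mod flip: int_pow_mult)
    also have "\<dots> \<in> powers N"
      using p d(1) subgroup_int_pow_closed[OF powers_subgroup] powers_closed(1) by blast
    finally have "x [^] int (nat (i mod int m)) \<in> powers N" using m(1) by simp
    moreover have "nat (i mod int m) < m" using m(1) by (simp add: nat_less_iff)
    ultimately have "nat (i mod int m) = 0"
      using not_less_Least[of "nat (i mod int m)" "\<lambda>m. m > 0 \<and> x [^] int m \<in> powers N"]
      unfolding m_def[symmetric] by auto
    then have "i mod int m = 0" using m(1) pos_mod_sign[of "int m" i] by linarith
    then have "i = int m * (i div int m)" using mult_div_mod_eq[of "int m" i] by simp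
    then have "p = d [^] (i div int m)" unfolding i d_def using x by (metis A_carrier int_pow_pow)
    then show ?thesis by blast
  qed
  have dd: "conjugate G t (conjugate G t d) = d"
  proof (cases "d = \<one>")
    case True
    then show ?thesis using t by (simp add: conjugate_def)
  next
    case False
    obtain i :: int where i: "conjugate G t d = d [^] i"
      using d_pow powers_closed(3)[OF t d(1)] by blast
    obtain j :: int where j: "conjugate G (inv t) d = d [^] j"
      using d_pow powers_closed(3)[OF _ d(1)] t by blast
    have "d = conjugate G t (d [^] j)" using t d(2) by (simp flip: j)
    also have "\<dots> = d [^] (i * j)" using t d(2) i by (simp add: conjugate_int_pow int_pow_pow)
    finally have "d [^] (i * j - 1) = \<one>" using d(2) by (simp add: int_pow_diff)
    then have "i * j - 1 = 0"
      using torsion_free_int[OF tf d(2) False] by blast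
    then have "i * i = 1" by (metis abs_mult_self_eq abs_zmult_eq_1 diff_eq_eq mult_1 add_0 abs_1)
    then show ?thesis using t d(2) i by (simp add: conjugate_int_pow int_pow_pow)
  qed
  have "conjugate G (t [^] (2::nat)) a \<otimes> inv a \<in> powers q" if a: "a \<in> A" for a
  proof -
    let ?b = "conjugate G (t [^] (2::nat)) a"
    have t2: "t [^] (2::nat) = t \<otimes> t" using t by (simp add: numeral_2_eq_2)
    have bA: "?b \<in> A" using a t by simp
    have "a [^] N \<in> powers N" unfolding powers_def using a by blast
    then obtain l :: int where l: "a [^] N = d [^] l" using d_pow by blast
    have "?b [^] N = conjugate G t (conjugate G t (d [^] l))"
      using a t by (simp add: t2 l conjugate_conjugate d flip: conjugate_nat_pow)
    also have "\<dots> = a [^] N" using t d(2) dd l by (simp add: conjugate_int_pow)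
    finally have "(?b \<otimes> inv a) [^] N = \<one>"
      using a bA by (simp add: power_mult nat_pow_inv)
    then have "?b \<otimes> inv a = \<one>" using torsion_freeD[OF tf, of "?b \<otimes> inv a" N] bA a N(1) by simp
    then show ?thesis using subgroup.one_closed[OF powers_subgroup] by simp
  qed
  then show ?thesis unfolding acts_trivially_mod_def by blast
qed

lemma max_condition_A:
  assumes "max_condition G (carrier G)" shows "max_condition (G\<lparr>carrier := A\<rparr>) A"
proof -
  have "max_condition G A"
    using assms subgroup_A subgroup.subset unfolding max_condition_def by (meson order_trans)
  then show ?thesis using max_condition_subgroup[OF subgroup_A subset_refl] by simp
qed

lemma powers_finite_index:
  assumes max: "max_condition G (carrier G)" and q: "q > 0"
  shows "finitely_many_cosets G (powers q) A"
proof -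
  interpret A: comm_group "G\<lparr>carrier := A\<rparr>" by (rule comm_group_A)
  have "subgroup (powers q) (G\<lparr>carrier := A\<rparr>)"
    using subgroup_incl[OF powers_subgroup subgroup_A powers_subset] .
  moreover have "\<exists>n::nat>0. a [^]\<^bsub>G\<lparr>carrier := A\<rparr>\<^esub> n \<in> powers q" if "a \<in> A" for a
    using q that unfolding powers_def by (intro exI[of _ q]) (simp flip: nat_pow_consistent)
  ultimately have "finitely_many_cosets (G\<lparr>carrier := A\<rparr>) (powers q) A"
    using A.finitely_many_cosets_if_power_in[of "powers q"] max_condition_A[OF max] by simp
  then show ?thesis
    unfolding finitely_many_cosets_def by auto
qed

end

section \<open>Virtually cyclic subgroups contain few classes modulo powers\<close>

context normal_abelian_subgroup
begin

definition adjoin :: "'a \<Rightarrow> 'a set"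
  where "adjoin t = A <#> generate G {t}"

lemma mem_adjoin_element_iff:
  "t \<in> carrier G \<Longrightarrow> g \<in> adjoin t \<longleftrightarrow> (\<exists>a\<in>A. \<exists>i::int. g = a \<otimes> t [^] i)"
  unfolding adjoin_def by (rule mem_adjoin_iff)

lemma adjoin_element_subgroup: "t \<in> carrier G \<Longrightarrow> subgroup (adjoin t) G"
  unfolding adjoin_def using mult_norm_subgroup[OF normal] generate_is_subgroup by simp

lemma coset_power:
  assumes g: "g \<in> carrier G" and y: "y \<in> A #> g"
  shows "y [^] (i::int) \<in> A #> g [^] i"
proof -
  interpret A: normal A G by (rule normal)
  have yG: "y \<in> carrier G" using y g unfolding r_coset_def by auto
  have "A #> y = A #> g" using repr_independence[OF y g subgroup_A] by simp
  then have "A #> y [^] i = A #> g [^] i"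
    using A.FactGroup_int_pow yG g by metis
  then show ?thesis using rcos_self[of "y [^] i" A] yG subgroup_A by simp
qed

text \<open>The quotient of \<open>A\<langle>t\<rangle>\<close> by \<open>A\<close> is commutative, so conjugation preserves cosets of \<open>A\<close>.\<close>

lemma conjugate_coset:
  assumes t: "t \<in> carrier G" and e: "e \<in> adjoin t" and y: "y \<in> A #> t [^] (k::nat)"
  shows "conjugate G e y \<in> A #> t [^] k"
proof -
  obtain b i where b: "b \<in> A" "e = b \<otimes> t [^] (i::int)" using e mem_adjoin_element_iff[OF t] by blast
  obtain a where a: "a \<in> A" "y = a \<otimes> t [^] k" using y unfolding r_coset_def by blast
  have comm: "conjugate G (t [^] i) (t [^] k) = t [^] k"
    unfolding conjugate_def using t
    by (simp add: int_pow_mult[symmetric] flip: int_pow_int int_pow_neg)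
  have "conjugate G e y = conjugate G b (conjugate G (t [^] i) a \<otimes> t [^] k)"
    using t a b comm by (simp add: conjugate_mult flip: conjugate_conjugate)
  also have "\<dots> = (b \<otimes> conjugate G (t [^] i) a \<otimes> conjugate G (t [^] k) (inv b)) \<otimes> t [^] k"
    using t a b by (simp add: conjugate_def m_assoc)
  finally show ?thesis using t a b unfolding r_coset_def by auto
qed

text \<open>If \<open>H\<close> contains \<open>y\<close> in the coset \<open>A t\<^sup>k\<close>, then \<open>y\<close> has infinite order modulo \<open>A\<close>.  A nontrivial
  element of \<open>H\<close> lying in \<open>A\<close> would have infinite order, hence a nontrivial power in common with \<open>y\<close>,
  which is impossible.  So \<open>H\<close> meets \<open>A\<close> trivially, and two elements of \<open>H\<close> in the same coset
  agree.\<close>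

lemma vc_subgroup_meets_coset_once:
  assumes tf: torsion_free
    and t: "t \<in> carrier G" and inf: "\<forall>i::int. t [^] i \<in> A \<longrightarrow> i = 0" and k: "k > (0::nat)"
    and vc: "vc_subgroup G H"
    and y: "y \<in> H" "y \<in> A #> t [^] k" and y': "y' \<in> H" "y' \<in> A #> t [^] k"
  shows "y = y'"
proof -
  have H: "subgroup H G" using vc unfolding vc_subgroup_def by blast
  obtain a a' where a: "a \<in> A" "y = a \<otimes> t [^] k" and a': "a' \<in> A" "y' = a' \<otimes> t [^] k"
    using y(2) y'(2) unfolding r_coset_def by blast
  define z where "z = y \<otimes> inv y'"
  have "z = a \<otimes> inv a'"
    unfolding z_def a(2) a'(2) using a a' t by (simp add: inv_mult_group m_assoc)
  then have zA: "z \<in> A" using a a' by simp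
  have zH: "z \<in> H" unfolding z_def using H y y' by (simp add: subgroup.m_closed subgroup.m_inv_closed)
  have powy: "i = 0" if "y [^] i \<in> A" for i :: int
  proof -
    obtain b where b: "b \<in> A" "y [^] i = b \<otimes> (t [^] k) [^] i"
      using coset_power[OF _ y(2), of i] t unfolding r_coset_def by auto
    have "inv b \<otimes> y [^] i \<in> A" using A_closed(1)[OF A_closed(2)[OF b(1)] that] .
    then have "(t [^] k) [^] i \<in> A" using b t by simp
    then have "t [^] (int k * i) \<in> A" using t by (simp add: int_pow_int flip: int_pow_pow)
    then show ?thesis using inf k by fastforce
  qed
  have "z = \<one>"
  proof (rule ccontr)
    assume "z \<noteq> \<one>"
    then obtain i j :: int where "i \<noteq> 0" "y [^] i = z [^] j"
      using vc_subgroup_commensurable[OF vc y(1) zH _ torsion_free_int[OF tf zA]] powy A_closed(3)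
      by metis
    then show False using powy[of i] zA by simp
  qed
  moreover have "y \<in> carrier G" "y' \<in> carrier G" using a a' t by auto
  ultimately show ?thesis unfolding z_def using inv_solve_right[of \<one> y y'] by simp
qed

text \<open>This is the preimage of the centralizer of the class of \<open>y\<close> in the quotient by the \<open>q\<close>-th powers
  of \<open>A\<close>.\<close>

lemma centralizer_mod_powers_subgroup:
  assumes y: "y \<in> carrier G"
  shows "subgroup {g \<in> carrier G. conjugate G g y \<otimes> inv y \<in> powers q} G" (is "subgroup ?Z G")
proof (rule subgroupI)
  show "?Z \<subseteq> carrier G" by blast
  have "\<one> \<in> ?Z" using y subgroup.one_closed[OF powers_subgroup] by simp
  then show "?Z \<noteq> {}" by blast
next
  fix g assume g: "g \<in> ?Z"
  then have gG: "g \<in> carrier G" by simp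
  have "conjugate G (inv g) y \<otimes> inv y = inv (conjugate G (inv g) (conjugate G g y \<otimes> inv y))"
    using gG y by (simp add: conjugate_mult conjugate_inv inv_mult_group)
  also have "\<dots> \<in> powers q" using g gG by (simp add: powers_closed)
  finally show "inv g \<in> ?Z" using gG by simp
next
  fix g h assume gh: "g \<in> ?Z" "h \<in> ?Z"
  then have G: "g \<in> carrier G" "h \<in> carrier G" by auto
  have "conjugate G (g \<otimes> h) y \<otimes> inv y
      = conjugate G g (conjugate G h y \<otimes> inv y) \<otimes> (conjugate G g y \<otimes> inv y)"
    using G y by (simp add: conjugate_mult conjugate_inv conjugate_conjugate m_assoc)
  also have "\<dots> \<in> powers q" using gh by (simp add: powers_closed)
  finally show "g \<otimes> h \<in> ?Z" using G by simp
qed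

text \<open>Modulo \<open>q\<close>-th powers the element \<open>y\<close> commutes with \<open>A\<close> and with \<open>t\<^sup>k\<close>, so its conjugate by
  \<open>b t\<^sup>s\<close> depends only on \<open>s\<close> modulo \<open>k\<close>.\<close>

lemma conjugates_congruent:
  assumes t: "t \<in> carrier G" and triv: "acts_trivially_mod q (t [^] (k::nat))"
    and y: "y \<in> A #> t [^] k" and b: "b \<in> A" and b': "b' \<in> A" and s: "int k dvd s - s'"
    and x: "x \<in> A" "x \<otimes> t [^] k = conjugate G (b \<otimes> t [^] s) y"
    and x': "x' \<in> A" "x' \<otimes> t [^] k = conjugate G (b' \<otimes> t [^] s') y"
  shows "x \<otimes> inv x' \<in> powers q"
proof -
  obtain a where a: "a \<in> A" "y = a \<otimes> t [^] k" using y unfolding r_coset_def by blast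
  have yG: "y \<in> carrier G" using a t by simp
  define Z where "Z = {g \<in> carrier G. conjugate G g y \<otimes> inv y \<in> powers q}"
  have Z: "subgroup Z G" unfolding Z_def by (rule centralizer_mod_powers_subgroup[OF yG])
  have AZ: "c \<in> Z" if c: "c \<in> A" for c
  proof -
    have "conjugate G c y \<otimes> inv y = c \<otimes> a \<otimes> conjugate G (t [^] k) (inv c) \<otimes> inv a"
      unfolding a(2) conjugate_def using a(1) c t by (simp add: m_assoc inv_mult_group)
    also have "\<dots> = c \<otimes> conjugate G (t [^] k) (inv c)"
      using a(1) c t commute[of "conjugate G (t [^] k) (inv c)" "inv a"] by (simp add: m_assoc)
    also have "\<dots> = conjugate G (t [^] k) (inv c) \<otimes> inv (inv c)"
      using c t by (simp add: commute)
    also have "\<dots> \<in> powers q"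
      using triv A_closed(2)[OF c] unfolding acts_trivially_mod_def by blast
    finally show ?thesis unfolding Z_def using c by simp
  qed
  have "conjugate G (t [^] k) y \<otimes> inv y = conjugate G (t [^] k) a \<otimes> inv a"
    unfolding a(2) conjugate_def using a(1) t by (simp add: m_assoc inv_mult_group)
  then have tZ: "t [^] k \<in> Z"
    using triv a(1) t unfolding Z_def acts_trivially_mod_def by auto
  obtain l where l: "s = s' + int k * l" using s by (metis dvdE add.commute diff_add_cancel)
  define e where "e = b \<otimes> t [^] s"
  define e' where "e' = b' \<otimes> t [^] s'"
  \<comment> \<open>The two conjugating elements differ by an element \<open>z\<close> centralizing \<open>y\<close> modulo \<open>q\<close>-th powers.\<close>
  define z where "z = inv e' \<otimes> e"
  have G: "e \<in> carrier G" "e' \<in> carrier G" unfolding e_def e'_def using t b b' by auto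
  have "z = conjugate G (inv (t [^] s')) (inv b' \<otimes> b) \<otimes> (t [^] k) [^] l"
    unfolding z_def e_def e'_def conjugate_def l using t b b'
    by (simp add: inv_mult_group m_assoc int_pow_mult int_pow_int flip: int_pow_pow)
  moreover have "conjugate G (inv (t [^] s')) (inv b' \<otimes> b) \<in> Z"
    using AZ t b b' by simp
  moreover have "(t [^] k) [^] l \<in> Z" by (rule subgroup_int_pow_closed[OF Z tZ])
  ultimately have "z \<in> Z" using subgroup.m_closed[OF Z] by simp
  then have zG: "z \<in> carrier G" and w: "conjugate G z y \<otimes> inv y \<in> powers q" unfolding Z_def by auto
  define w where "w = conjugate G z y \<otimes> inv y"
  have wG: "w \<in> carrier G" unfolding w_def using zG yG by simp
  have "conjugate G z y = w \<otimes> y" unfolding w_def using zG yG by (simp add: m_assoc)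
  moreover have "e = e' \<otimes> z" unfolding z_def using G by simp
  ultimately have "x \<otimes> t [^] k = conjugate G e' w \<otimes> (x' \<otimes> t [^] k)"
    using x(2) x'(2) G zG yG wG
    by (simp add: conjugate_mult flip: conjugate_conjugate e_def e'_def)
  then have "x = conjugate G e' w \<otimes> x'"
    using x(1) x'(1) t G wG by (simp flip: m_assoc)
  then have "x \<otimes> inv x' = conjugate G e' w"
    using x'(1) G wG by (simp add: m_assoc)
  then show ?thesis using w powers_closed(3)[OF G(2)] unfolding w_def by simp
qed

text \<open>Each \<open>a t\<^sup>k\<close> with \<open>a\<close> in \<open>S\<close> is conjugate to the unique element of the coset \<open>A t\<^sup>k\<close> in some
  \<open>H\<close>; the pair of \<open>H\<close> and the exponent of \<open>t\<close> modulo \<open>k\<close> in the conjugating element determines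
  \<open>a\<close> modulo \<open>q\<close>-th powers, and hence \<open>a\<close> itself.\<close>

lemma card_separated_le_if_infinite_order:
  assumes tf: torsion_free
    and t: "t \<in> carrier G" and inf: "\<forall>i::int. t [^] i \<in> A \<longrightarrow> i = 0"
    and fin: "finite \<H>" and vc: "\<And>H. H \<in> \<H> \<Longrightarrow> vc_subgroup G H"
    and cover: "\<And>x. x \<in> adjoin t \<Longrightarrow> \<exists>H\<in>\<H>. \<exists>e\<in>adjoin t. \<exists>y\<in>H. x = conjugate G e y"
    and k: "k > (0::nat)" and triv: "acts_trivially_mod q (t [^] k)"
    and S: "separated_mod_powers (G\<lparr>carrier := A\<rparr>) q S"
  shows "card S \<le> card \<H> * k"
proof -
  have SA: "finite S" "S \<subseteq> A" using separated_subset[OF S] by auto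
  define hit where "hit H x \<longleftrightarrow> (\<exists>b\<in>A. \<exists>s::int. \<exists>y\<in>H. x \<otimes> t [^] k = conjugate G (b \<otimes> t [^] s) y)" for H x
  have "\<exists>H\<in>\<H>. hit H x" if x: "x \<in> S" for x
  proof -
    have "x \<otimes> t [^] int k \<in> adjoin t"
      unfolding mem_adjoin_element_iff[OF t] using x SA by blast
    then obtain H e y where "H \<in> \<H>" "e \<in> adjoin t" "y \<in> H" "x \<otimes> t [^] k = conjugate G e y"
      using cover by (metis int_pow_int)
    then show ?thesis unfolding hit_def mem_adjoin_element_iff[OF t] by blast
  qed
  then have "S \<subseteq> (\<Union>H\<in>\<H>. {x \<in> S. hit H x})" by blast
  then have "card S \<le> card (\<Union>H\<in>\<H>. {x \<in> S. hit H x})"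
    using SA fin by (intro card_mono) auto
  also have "\<dots> \<le> (\<Sum>H\<in>\<H>. card {x \<in> S. hit H x})"
    by (rule card_UN_le[OF fin])
  also have "\<dots> \<le> (\<Sum>H\<in>\<H>. k)"
  proof (rule sum_mono)
    fix H assume H: "H \<in> \<H>"
    have "\<exists>b s y. x \<in> S \<and> hit H x \<longrightarrow>
        b \<in> A \<and> y \<in> H \<and> x \<otimes> t [^] k = conjugate G (b \<otimes> t [^] (s::int)) y" for x
      unfolding hit_def by blast
    then obtain b s y where bsy: "\<And>x. x \<in> S \<and> hit H x \<longrightarrow>
        b x \<in> A \<and> y x \<in> H \<and> x \<otimes> t [^] k = conjugate G (b x \<otimes> t [^] (s x::int)) (y x)"
      by metis
    have sH: "subgroup H G" using vc[OF H] unfolding vc_subgroup_def by blast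
    have ycos: "y x \<in> A #> t [^] k" if x: "x \<in> S \<and> hit H x" for x
    proof -
      let ?e = "b x \<otimes> t [^] s x"
      have e: "?e \<in> adjoin t" using mem_adjoin_element_iff[OF t] bsy x by blast
      have eG: "?e \<in> carrier G" using bsy[of x] x t by simp
      have "y x = conjugate G (inv ?e) (x \<otimes> t [^] k)"
        using bsy[of x] x eG sH by (simp add: subgroup.mem_carrier)
      moreover have "x \<otimes> t [^] k \<in> A #> t [^] k"
        unfolding r_coset_def using x SA by blast
      ultimately show ?thesis
        using conjugate_coset[OF t subgroup.m_inv_closed[OF adjoin_element_subgroup[OF t] e]] by simp
    qed
    have "inj_on (\<lambda>x. nat (s x mod int k)) {x \<in> S. hit H x}"
    proof (rule inj_onI)
      fix x x' assume "x \<in> {x \<in> S. hit H x}" "x' \<in> {x \<in> S. hit H x}"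
        and eq: "nat (s x mod int k) = nat (s x' mod int k)"
      then have x: "x \<in> S \<and> hit H x" and x': "x' \<in> S \<and> hit H x'" by auto
      have "s x mod int k = s x' mod int k"
        using eq k by (simp add: eq_nat_nat_iff)
      then have dvd: "int k dvd s x - s x'" by (simp add: mod_eq_dvd_iff)
      have "y x = y x'"
        using vc_subgroup_meets_coset_once[OF tf t inf k vc[OF H] _ ycos[OF x] _ ycos[OF x']]
          bsy[of x] bsy[of x'] x x' by blast
      moreover have "x \<in> A" "x' \<in> A" using x x' SA by auto
      ultimately have "x \<otimes> inv x' \<in> powers q"
        using bsy[of x] bsy[of x'] x x'
        by (intro conjugates_congruent[OF t triv ycos[OF x], where s = "s x" and s' = "s x'"
              and b = "b x" and b' = "b x'"]) (simp_all add: dvd)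
      then show "x = x'" using separatedD[OF S] x x' by blast
    qed
    moreover have "(\<lambda>x. nat (s x mod int k)) ` {x \<in> S. hit H x} \<subseteq> {..<k}"
      using k by (auto simp: nat_less_iff)
    ultimately have "card {x \<in> S. hit H x} \<le> card {..<k}"
      by (intro card_inj_on_le) auto
    then show "card {x \<in> S. hit H x} \<le> k" by simp
  qed
  finally show ?thesis by simp
qed

text \<open>Let \<open>c\<close> generate a cyclic subgroup of finite index in \<open>H\<close>, and let \<open>c\<^sup>N\<close> lie in \<open>A\<close>.  Then two
  elements \<open>c\<^sup>i r\<close> of \<open>H\<close> with the same \<open>r\<close> and with exponents \<open>i\<close> congruent modulo \<open>N q\<close> are
  congruent modulo \<open>q\<close>-th powers.\<close>

lemma card_separated_in_vc_subgroup:
  assumes fin: "finitely_many_cosets G A (carrier G)" and vc: "vc_subgroup G H"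
  obtains C where "\<And>q S. q > 0 \<Longrightarrow> S \<subseteq> H \<Longrightarrow> separated_mod_powers (G\<lparr>carrier := A\<rparr>) q S
    \<Longrightarrow> card S \<le> C * q"
proof -
  obtain c where H: "subgroup H G" and c: "c \<in> H" "finitely_many_cosets G (generate G {c}) H"
    using vc unfolding vc_subgroup_def by blast
  have cG: "c \<in> carrier G" using H c(1) by (simp add: subgroup.mem_carrier)
  obtain R where R: "finite R" "R \<subseteq> carrier G"
    "\<And>g. g \<in> H \<Longrightarrow> \<exists>k\<in>generate G {c}. \<exists>r\<in>R. g = k \<otimes> r"
    using c(2) unfolding finitely_many_cosets_def by blast
  have "\<exists>i r. g \<in> H \<longrightarrow> r \<in> R \<and> g = c [^] (i::int) \<otimes> r" for g
    using R(3)[of g] unfolding generate_pow[OF cG] by blast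
  then obtain i r where ir: "\<And>g. g \<in> H \<Longrightarrow> r g \<in> R \<and> g = c [^] (i g::int) \<otimes> r g" by metis
  obtain N :: nat where N: "N > 0" "c [^] N \<in> A"
    using power_in_finite_index_subgroup[OF subgroup_A fin subgroup_self cG] by blast
  have "card S \<le> card R * N * q"
    if q: "q > 0" and SH: "S \<subseteq> H" and S: "separated_mod_powers (G\<lparr>carrier := A\<rparr>) q S" for q S
  proof -
    let ?f = "\<lambda>x. (r x, nat (i x mod int (N * q)))"
    have pos: "int (N * q) > 0" using N(1) q by simp
    have "inj_on ?f S"
    proof (rule inj_onI)
      fix x x' assume x: "x \<in> S" "x' \<in> S" "?f x = ?f x'"
      then have "i x mod int (N * q) = i x' mod int (N * q)"
        using pos by (simp add: eq_nat_nat_iff del: of_nat_mult)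
      then have "int (N * q) dvd i x - i x'" by (simp add: mod_eq_dvd_iff)
      then obtain l where l: "i x - i x' = int N * l * int q"
        by (metis dvdE mult.assoc mult.commute of_nat_mult)
      have rG: "r x \<in> carrier G" using ir[of x] x(1) SH R(2) by blast
      have e: "x = c [^] i x \<otimes> r x" "x' = c [^] i x' \<otimes> r x"
        using ir[of x] ir[of x'] x SH by auto
      have "x \<otimes> inv x' = c [^] (i x - i x')"
        by (subst e(1), subst e(2)) (use cG rG in \<open>simp add: inv_mult_group m_assoc int_pow_diff\<close>)
      also have "\<dots> = ((c [^] N) [^] l) [^] q"
        unfolding l using cG by (simp add: int_pow_int flip: int_pow_pow)
      also have "\<dots> \<in> powers q" unfolding powers_def using N(2) by blast
      finally show "x = x'" using separatedD[OF S x(1,2)] by blast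
    qed
    moreover have "?f ` S \<subseteq> R \<times> {..<N * q}"
      using ir SH pos by (auto simp: nat_less_iff simp del: of_nat_mult)
    ultimately have "card S \<le> card (R \<times> {..<N * q})"
      using R(1) by (intro card_inj_on_le) auto
    then show ?thesis by (simp add: card_cartesian_product mult.assoc)
  qed
  then show thesis using that by blast
qed

lemma card_separated_le_if_finite_index:
  assumes idx: "finitely_many_cosets G A (carrier G)"
    and fin: "finite \<H>" and vc: "\<And>H. H \<in> \<H> \<Longrightarrow> vc_subgroup G H"
    and cover: "A \<subseteq> \<Union>\<H>"
  obtains C where "\<And>q S. q > 0 \<Longrightarrow> separated_mod_powers (G\<lparr>carrier := A\<rparr>) q S \<Longrightarrow> card S \<le> C * q"
proof -
  have "\<exists>C. \<forall>q S. q > 0 \<longrightarrow> S \<subseteq> H \<longrightarrow> separated_mod_powers (G\<lparr>carrier := A\<rparr>) q S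
      \<longrightarrow> card S \<le> C * q" if "H \<in> \<H>" for H
    using card_separated_in_vc_subgroup[OF idx vc[OF that]] by metis
  then obtain C where C: "\<And>H q S. H \<in> \<H> \<Longrightarrow> q > 0 \<Longrightarrow> S \<subseteq> H \<Longrightarrow>
      separated_mod_powers (G\<lparr>carrier := A\<rparr>) q S \<Longrightarrow> card S \<le> C H * q"
    by metis
  have "card S \<le> (\<Sum>H\<in>\<H>. C H) * q"
    if q: "q > 0" and S: "separated_mod_powers (G\<lparr>carrier := A\<rparr>) q S" for q S
  proof -
    have SA: "finite S" "S \<subseteq> A" using separated_subset[OF S] by auto
    have "S \<subseteq> (\<Union>H\<in>\<H>. S \<inter> H)" using SA cover by blast
    then have "card S \<le> card (\<Union>H\<in>\<H>. S \<inter> H)"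
      using SA fin by (intro card_mono) auto
    also have "\<dots> \<le> (\<Sum>H\<in>\<H>. card (S \<inter> H))" by (rule card_UN_le[OF fin])
    also have "\<dots> \<le> (\<Sum>H\<in>\<H>. C H * q)"
    proof (rule sum_mono)
      fix H assume "H \<in> \<H>"
      moreover have "separated_mod_powers (G\<lparr>carrier := A\<rparr>) q (S \<inter> H)"
        using S unfolding separated_mod_powers_def by auto
      ultimately show "card (S \<inter> H) \<le> C H * q" using C q by blast
    qed
    finally show ?thesis by (simp add: sum_distrib_right)
  qed
  then show thesis using that by blast
qed

end

section \<open>Groups all of whose proper quotients are virtually cyclic\<close>

context group
begin

text \<open>A conjugating element is the product of an element of \<open>E\<close> and of one of finitely many coset
  representatives; the representative is absorbed by conjugating the members of \<open>\<F>\<close> with it.\<close>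

lemma conjugacy_cover_finite_index:
  assumes fin: "finite \<F>" and vc: "\<And>H. H \<in> \<F> \<Longrightarrow> vc_subgroup G H"
    and cover: "\<And>x. x \<in> carrier G \<Longrightarrow> \<exists>H\<in>\<F>. \<exists>g\<in>carrier G. \<exists>y\<in>H. x = conjugate G g y"
    and E: "E \<subseteq> carrier G" "finitely_many_cosets G E (carrier G)"
  obtains \<H> where "finite \<H>" "\<And>H. H \<in> \<H> \<Longrightarrow> vc_subgroup G H"
    "\<And>x. x \<in> carrier G \<Longrightarrow> \<exists>H\<in>\<H>. \<exists>e\<in>E. \<exists>y\<in>H. x = conjugate G e y"
proof -
  obtain R where R: "finite R" "R \<subseteq> carrier G" "\<And>g. g \<in> carrier G \<Longrightarrow> \<exists>e\<in>E. \<exists>r\<in>R. g = e \<otimes> r"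
    using E(2) unfolding finitely_many_cosets_def by blast
  let ?\<H> = "(\<lambda>(r, H). conjugate G r ` H) ` (R \<times> \<F>)"
  show thesis
  proof (rule that[of ?\<H>])
    show "finite ?\<H>" using fin R(1) by simp
  next
    fix K assume "K \<in> ?\<H>"
    then obtain r H where rH: "r \<in> R" "H \<in> \<F>" "K = conjugate G r ` H" by blast
    have "group_hom G G (conjugate G r)" using rH(1) R(2) conjugate_hom by blast
    then show "vc_subgroup G K"
      unfolding rH(3) using group_hom.vc_subgroup_image vc[OF rH(2)] by blast
  next
    fix x assume "x \<in> carrier G"
    then obtain H g y where H: "H \<in> \<F>" "g \<in> carrier G" "y \<in> H" "x = conjugate G g y"
      using cover by blast
    obtain e r where er: "e \<in> E" "r \<in> R" "g = e \<otimes> r" using R(3) H(2) by blast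
    have "y \<in> carrier G"
      using vc[OF H(1)] H(3) unfolding vc_subgroup_def by (auto simp: subgroup.mem_carrier)
    then have "x = conjugate G e (conjugate G r y)"
      using H(4) er E(1) R(2) by (simp add: conjugate_conjugate subset_iff)
    then have hit: "\<exists>e\<in>E. \<exists>y\<in>conjugate G r ` H. x = conjugate G e y"
      using er(1) H(3) by blast
    have "conjugate G r ` H \<in> ?\<H>" using H(1) er(2) by blast
    then show "\<exists>K\<in>?\<H>. \<exists>e\<in>E. \<exists>y\<in>K. x = conjugate G e y"
      using hit by (rule rev_bexI)
  qed
qed

lemma finite_normal_by_cyclic:
  assumes F: "F \<lhd> G" "finite F" and c: "c \<in> carrier G"
    and fin: "finitely_many_cosets G (F <#> generate G {c}) (carrier G)"
  shows "finitely_many_cosets G (generate G {c}) (carrier G)"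
proof -
  have gen: "subgroup (generate G {c}) G" using c by (simp add: generate_is_subgroup)
  have "F <#> generate G {c} = generate G {c} <#> F"
    using commut_normal[OF gen F(1)] by simp
  moreover have "F \<subseteq> carrier G" using F(1) normal_imp_subgroup subgroup.subset by blast
  ultimately have "finitely_many_cosets G (generate G {c}) (F <#> generate G {c})"
    unfolding finitely_many_cosets_def using F(2)
    by (intro exI[of _ F]) (auto simp: set_mult_def)
  then show ?thesis
    using finitely_many_cosets_trans[OF subgroup.subset[OF gen] _ fin] by blast
qed

end

text \<open>The quotient of \<open>3\<^sup>e\<close> by \<open>2\<^sup>e\<close> is unbounded: Bernoulli's inequality gives at least
  \<open>(e + 2) / 2\<close>, so \<open>e = 2 C\<close> serves.\<close>

lemma exponential_gap: "\<exists>e. C * 2 ^ e < (3::nat) ^ e"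
proof -
  have "(e + 2) * 2 ^ e \<le> 2 * (3::nat) ^ e" for e
  proof (induction e)
    case (Suc e)
    have "(Suc e + 2) * 2 ^ Suc e \<le> 3 * ((e + 2) * 2 ^ e)" by (simp add: algebra_simps)
    also have "\<dots> \<le> 3 * (2 * 3 ^ e)" using Suc by (rule mult_le_mono2)
    finally show ?case by simp
  qed simp
  from this[of "2 * C"] have "(2 * C + 2) * 2 ^ (2 * C) \<le> 2 * (3::nat) ^ (2 * C)" .
  moreover have "(2 * C + 2) * 2 ^ (2 * C) = 2 * (C * 2 ^ (2 * C)) + 2 * (2::nat) ^ (2 * C)"
    by (simp add: algebra_simps)
  moreover have "(2::nat) ^ (2 * C) > 0" by simp
  ultimately have "C * 2 ^ (2 * C) < (3::nat) ^ (2 * C)" by linarith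
  then show ?thesis by blast
qed

context normal_abelian_subgroup
begin

lemma finite_torsion_normal:
  assumes max: "max_condition G (carrier G)"
  defines "T \<equiv> {a \<in> A. \<exists>n::nat>0. a [^] n = \<one>}"
  shows "T \<lhd> G" "finite T"
proof -
  have T: "subgroup T G"
  proof (rule subgroupI)
    show "T \<subseteq> carrier G" unfolding T_def by auto
    have "\<one> \<in> T" unfolding T_def by (auto intro!: exI[of _ 1])
    then show "T \<noteq> {}" by blast
  next
    fix a assume "a \<in> T"
    then show "inv a \<in> T" unfolding T_def by (auto simp: nat_pow_inv)
  next
    fix a b assume "a \<in> T" "b \<in> T"
    then obtain m n :: nat where mn: "m > 0" "a [^] m = \<one>" "n > 0" "b [^] n = \<one>" "a \<in> A" "b \<in> A"
      unfolding T_def by blast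
    have "(a \<otimes> b) [^] (m * n) = (a [^] m) [^] n \<otimes> (b [^] n) [^] m"
      using mn(5,6) by (simp add: power_mult nat_pow_pow mult.commute)
    also have "\<dots> = \<one>" by (simp add: mn)
    finally have "(a \<otimes> b) [^] (m * n) = \<one>" "m * n > 0" using mn by auto
    then show "a \<otimes> b \<in> T" unfolding T_def using mn(5,6) by blast
  qed
  have TA: "T \<subseteq> A" unfolding T_def by blast
  show normT: "T \<lhd> G"
  proof (rule normalI_conjugate[OF T])
    fix g a assume g: "g \<in> carrier G" "a \<in> T"
    then obtain n :: nat where n: "n > 0" "a [^] n = \<one>" "a \<in> A" unfolding T_def by blast
    have "conjugate G g a [^] n = conjugate G g (a [^] n)"
      using g(1) n(3) by (simp add: conjugate_nat_pow)
    also have "\<dots> = \<one>" using n(2) g(1) by (simp add: conjugate_def)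
    finally show "conjugate G g a \<in> T" unfolding T_def using g(1) n by auto
  qed
  interpret T: normal_abelian_subgroup G T
    by (intro normal_abelian_subgroup.intro normal_abelian_subgroup_axioms.intro is_group normT)
      (use TA commute in blast)
  interpret TC: comm_group "G\<lparr>carrier := T\<rparr>" by (rule T.comm_group_A)
  have "subgroup {\<one>} (G\<lparr>carrier := T\<rparr>)"
    using TC.triv_subgroup by simp
  moreover have "\<exists>n::nat>0. a [^]\<^bsub>G\<lparr>carrier := T\<rparr>\<^esub> n \<in> {\<one>}" if "a \<in> T" for a
    using that unfolding T_def by (auto simp flip: nat_pow_consistent)
  ultimately have "finitely_many_cosets (G\<lparr>carrier := T\<rparr>) {\<one>} T"
    using TC.finitely_many_cosets_if_power_in[of "{\<one>}"] T.max_condition_A[OF max] by simp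
  then obtain R where R: "finite R" "R \<subseteq> T" "\<And>a. a \<in> T \<Longrightarrow> \<exists>r\<in>R. a = \<one> \<otimes> r"
    unfolding finitely_many_cosets_def by auto
  have "a \<in> R" if a: "a \<in> T" for a
  proof -
    obtain r where r: "r \<in> R" "a = \<one> \<otimes> r" using R(3)[OF a] by blast
    have "r \<in> carrier G" using r(1) R(2) T.A_carrier by blast
    then show ?thesis using r by simp
  qed
  then have "T \<subseteq> R" by blast
  then show "finite T" using R(1) by (rule finite_subset)
qed

lemma finite_index_if_power_in:
  assumes t: "t \<in> carrier G" and i: "t [^] (i::int) \<in> A" "i \<noteq> 0"
  shows "finitely_many_cosets G A (adjoin t)"
proof -
  define n where "n = nat \<bar>i\<bar>"
  have n: "n > 0" unfolding n_def using i(2) by simp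
  have "t [^] \<bar>i\<bar> \<in> A" using i(1) t by (simp add: abs_if int_pow_neg)
  then have tn: "t [^] n \<in> A" unfolding n_def by (simp flip: int_pow_int)
  have "\<exists>k\<in>A. \<exists>r\<in>(\<lambda>j::nat. t [^] j) ` {..<n}. g = k \<otimes> r" if g: "g \<in> adjoin t" for g
  proof -
    obtain a j where aj: "a \<in> A" "g = a \<otimes> t [^] (j::int)"
      using g unfolding mem_adjoin_element_iff[OF t] by blast
    have "t [^] j = (t [^] n) [^] (j div int n) \<otimes> t [^] nat (j mod int n)"
      using t n by (simp flip: int_pow_int int_pow_mult add: int_pow_pow)
    then have "g = (a \<otimes> (t [^] n) [^] (j div int n)) \<otimes> t [^] nat (j mod int n)"
      "a \<otimes> (t [^] n) [^] (j div int n) \<in> A" "nat (j mod int n) \<in> {..<n}"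
      using aj t tn n by (simp_all add: m_assoc nat_less_iff)
    then show ?thesis by blast
  qed
  then show ?thesis
    unfolding finitely_many_cosets_def using t
    by (intro exI[of _ "(\<lambda>j::nat. t [^] j) ` {..<n}"]) auto
qed

lemma separated_powers:
  assumes tf: torsion_free and S: "separated_mod_powers (G\<lparr>carrier := A\<rparr>) 2 S"
  obtains Y where "separated_mod_powers (G\<lparr>carrier := A\<rparr>) (2 ^ e) Y" "card Y = card S ^ e"
proof -
  interpret A: comm_group "G\<lparr>carrier := A\<rparr>" by (rule comm_group_A)
  have "a = \<one>\<^bsub>G\<lparr>carrier := A\<rparr>\<^esub>"
    if "a \<in> carrier (G\<lparr>carrier := A\<rparr>)" "n > (0::nat)"
      "a [^]\<^bsub>G\<lparr>carrier := A\<rparr>\<^esub> n = \<one>\<^bsub>G\<lparr>carrier := A\<rparr>\<^esub>" for a n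
    using torsion_freeD[OF tf, of a n] that by (simp flip: nat_pow_consistent)
  then show thesis using A.separated_iterate[OF _ S] that by blast
qed

text \<open>The two cases separate rank at least two from rank at most one when \<open>A\<close> is torsion-free.\<close>

lemma rank_dichotomy:
  assumes max: "max_condition G (carrier G)"
  obtains (triple) S where "separated_mod_powers (G\<lparr>carrier := A\<rparr>) 2 S" "card S = 3"
  | (cyclic) x where "x \<in> A" "finitely_many_cosets G (generate G {x}) A"
proof -
  interpret A: comm_group "G\<lparr>carrier := A\<rparr>" by (rule comm_group_A)
  have maxA: "max_condition (G\<lparr>carrier := A\<rparr>) (carrier (G\<lparr>carrier := A\<rparr>))"
    using max_condition_A[OF max] by simp
  show thesis
  proof (rule A.separated_triple_or_power_in_cyclic[OF maxA])
    fix S assume "separated_mod_powers (G\<lparr>carrier := A\<rparr>) 2 S" "card S = 3"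
    then show thesis by (rule triple)
  next
    fix x assume x: "x \<in> carrier (G\<lparr>carrier := A\<rparr>)"
      and pow: "\<And>a. a \<in> carrier (G\<lparr>carrier := A\<rparr>) \<Longrightarrow>
        \<exists>n::nat>0. a [^]\<^bsub>G\<lparr>carrier := A\<rparr>\<^esub> n \<in> generate (G\<lparr>carrier := A\<rparr>) {x}"
    have gen: "generate (G\<lparr>carrier := A\<rparr>) {x} = generate G {x}"
      using generate_consistent[of "{x}" A] x subgroup_A by simp
    have "subgroup (generate (G\<lparr>carrier := A\<rparr>) {x}) (G\<lparr>carrier := A\<rparr>)"
      using x by (intro A.generate_is_subgroup) simp
    then have "finitely_many_cosets (G\<lparr>carrier := A\<rparr>) (generate G {x}) A"
      using A.finitely_many_cosets_if_power_in[OF maxA _ pow] unfolding gen by simp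
    then have "finitely_many_cosets G (generate G {x}) A"
      unfolding finitely_many_cosets_def by auto
    then show thesis using cyclic[of x] x by simp
  qed
qed

lemma separated_pair_exists:
  assumes max: "max_condition G (carrier G)" and tf: torsion_free and nontriv: "A \<noteq> {\<one>}"
  obtains S where "separated_mod_powers (G\<lparr>carrier := A\<rparr>) 2 S" "card S = 2"
proof -
  interpret A: comm_group "G\<lparr>carrier := A\<rparr>" by (rule comm_group_A)
  have "a = \<one>\<^bsub>G\<lparr>carrier := A\<rparr>\<^esub>"
    if "a \<in> carrier (G\<lparr>carrier := A\<rparr>)" "n > (0::nat)"
      "a [^]\<^bsub>G\<lparr>carrier := A\<rparr>\<^esub> n = \<one>\<^bsub>G\<lparr>carrier := A\<rparr>\<^esub>" for a n
    using torsion_freeD[OF tf, of a n] that by (simp flip: nat_pow_consistent)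
  then show thesis
    using A.separated_pair[of thesis] max_condition_A[OF max] nontriv that by simp
qed

lemma powers_in_cyclic:
  assumes x: "x \<in> A" and fin: "finitely_many_cosets G (generate G {x}) A"
  obtains N :: nat where "N > 0" "powers N \<subseteq> generate G {x}"
proof -
  interpret A: comm_group "G\<lparr>carrier := A\<rparr>" by (rule comm_group_A)
  have gen: "subgroup (generate G {x}) G" using x by (simp add: generate_is_subgroup)
  have genA: "generate G {x} \<subseteq> A"
    using generate_subgroup_incl[of "{x}" A] x subgroup_A by simp
  obtain R where R: "finite R" "R \<subseteq> carrier G" "\<And>a. a \<in> A \<Longrightarrow> \<exists>k\<in>generate G {x}. \<exists>r\<in>R. a = k \<otimes> r"
    using fin unfolding finitely_many_cosets_def by blast
  have "\<exists>k\<in>generate G {x}. \<exists>r\<in>R \<inter> A. a = k \<otimes> r" if a: "a \<in> A" for a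
  proof -
    obtain k r where kr: "k \<in> generate G {x}" "r \<in> R" "a = k \<otimes> r" using R(3) a by blast
    have k: "k \<in> A" using kr(1) genA by blast
    have "r = inv k \<otimes> a" using kr R(2) k by auto
    then have "r \<in> A" using k a by simp
    then show ?thesis using kr by blast
  qed
  then have "finitely_many_cosets (G\<lparr>carrier := A\<rparr>) (generate G {x}) A"
    unfolding finitely_many_cosets_def using R(1) by (intro exI[of _ "R \<inter> A"]) simp
  then obtain N :: nat where N: "N > 0"
    "\<And>a. a \<in> carrier (G\<lparr>carrier := A\<rparr>) \<Longrightarrow> a [^]\<^bsub>G\<lparr>carrier := A\<rparr>\<^esub> N \<in> generate G {x}"
    using A.uniform_exponent[of "generate G {x}"] subgroup_incl[OF gen subgroup_A genA] by auto
  have "powers N \<subseteq> generate G {x}"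
    unfolding powers_def using N(2) by (auto simp flip: nat_pow_consistent)
  then show thesis using that N(1) by blast
qed

text \<open>The number of classes of \<open>A\<close> modulo \<open>2\<^sup>e\<close>-th powers is bounded from below by \<open>separated_powers\<close>
  and from above by conjugacy.  For large \<open>e\<close> the bounds collide, except when \<open>A\<close> has finite index
  in \<open>G\<close> and a cyclic subgroup of finite index.\<close>

lemma virtually_cyclic_if_torsion_free:
  assumes max: "max_condition G (carrier G)" and tf: torsion_free and nontriv: "A \<noteq> {\<one>}"
    and fin: "finite \<F>" and vc: "\<And>H. H \<in> \<F> \<Longrightarrow> vc_subgroup G H"
    and cover: "\<And>x. x \<in> carrier G \<Longrightarrow> \<exists>H\<in>\<F>. \<exists>g\<in>carrier G. \<exists>y\<in>H. x = conjugate G g y"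
    and t: "t \<in> carrier G" and ext: "finitely_many_cosets G (adjoin t) (carrier G)"
  shows "\<exists>c\<in>carrier G. finitely_many_cosets G (generate G {c}) (carrier G)"
proof (cases "\<forall>i::int. t [^] i \<in> A \<longrightarrow> i = 0")
  case False
  have AG: "A \<subseteq> carrier G" by auto
  have idx: "finitely_many_cosets G A (carrier G)"
    using finitely_many_cosets_trans[OF AG finite_index_if_power_in[OF t] ext] False by blast
  obtain \<H> where \<H>: "finite \<H>" "\<And>H. H \<in> \<H> \<Longrightarrow> vc_subgroup G H"
    "\<And>x. x \<in> carrier G \<Longrightarrow> \<exists>H\<in>\<H>. \<exists>e\<in>A. \<exists>y\<in>H. x = conjugate G e y"
    using conjugacy_cover_finite_index[OF fin vc cover AG idx] by blast
  have "A \<subseteq> \<Union>\<H>"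
  proof
    fix x assume x: "x \<in> A"
    then obtain H e y where H: "H \<in> \<H>" "e \<in> A" "y \<in> H" "x = conjugate G e y"
      using \<H>(3) by blast
    have yG: "y \<in> carrier G"
      using \<H>(2)[OF H(1)] H(3) unfolding vc_subgroup_def by (auto simp: subgroup.mem_carrier)
    have "y = conjugate G (inv e) x" using H yG by simp
    also have "\<dots> = x" using H(2) x by (simp add: conjugate_def commute[of _ x] m_assoc)
    finally show "x \<in> \<Union>\<H>" using H by blast
  qed
  then obtain C where C: "\<And>q S. q > 0 \<Longrightarrow> separated_mod_powers (G\<lparr>carrier := A\<rparr>) q S \<Longrightarrow> card S \<le> C * q"
    using card_separated_le_if_finite_index[OF idx \<H>(1,2)] by blast
  show ?thesis
  proof (rule rank_dichotomy[OF max])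
    fix S assume S: "separated_mod_powers (G\<lparr>carrier := A\<rparr>) 2 S" "card S = 3"
    obtain e where e: "C * 2 ^ e < (3::nat) ^ e" using exponential_gap by blast
    obtain Y where "separated_mod_powers (G\<lparr>carrier := A\<rparr>) (2 ^ e) Y" "card Y = 3 ^ e"
      using separated_powers[OF tf S(1), of e] S(2) by metis
    then show ?thesis using C[of "2 ^ e" Y] e by simp
  next
    fix x assume x: "x \<in> A" "finitely_many_cosets G (generate G {x}) A"
    have "generate G {x} \<subseteq> carrier G" using x(1) by (simp add: generate_incl)
    then show ?thesis using finitely_many_cosets_trans[OF _ x(2) idx] x(1) by blast
  qed
next
  case True
  have EG: "adjoin t \<subseteq> carrier G" by (rule subgroup.subset[OF adjoin_element_subgroup[OF t]])
  obtain \<H> where \<H>: "finite \<H>" "\<And>H. H \<in> \<H> \<Longrightarrow> vc_subgroup G H"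
    "\<And>x. x \<in> carrier G \<Longrightarrow> \<exists>H\<in>\<H>. \<exists>e\<in>adjoin t. \<exists>y\<in>H. x = conjugate G e y"
    using conjugacy_cover_finite_index[OF fin vc cover EG ext] by blast
  have bound: "card S \<le> card \<H> * k"
    if "k > 0" "acts_trivially_mod q (t [^] k)" "separated_mod_powers (G\<lparr>carrier := A\<rparr>) q S" for q k S
    using card_separated_le_if_infinite_order[OF tf t True \<H>(1,2) _ that] \<H>(3)[OF subsetD[OF EG]] by blast
  show ?thesis
  proof (rule rank_dichotomy[OF max])
    fix S assume S: "separated_mod_powers (G\<lparr>carrier := A\<rparr>) 2 S" "card S = 3"
    obtain k :: nat where k: "k > 0" "acts_trivially_mod 2 (t [^] k)"
      using acts_trivially_mod_two[OF powers_finite_index[OF max] t] by auto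
    obtain e where e: "card \<H> * k * 2 ^ e < (3::nat) ^ e" using exponential_gap by blast
    obtain Y where Y: "separated_mod_powers (G\<lparr>carrier := A\<rparr>) (2 ^ Suc e) Y" "card Y = 3 ^ Suc e"
      using separated_powers[OF tf S(1), of "Suc e"] S(2) by metis
    have "3 ^ Suc e \<le> card \<H> * (k * 2 ^ e)"
      using bound[OF _ acts_trivially_mod_two_powers[OF t k(2)] Y(1)] k(1) Y(2) by simp
    also have "\<dots> < 3 ^ e" using e by (simp add: mult.assoc)
    finally show ?thesis by simp
  next
    fix x assume x: "x \<in> A" "finitely_many_cosets G (generate G {x}) A"
    obtain N :: nat where N: "N > 0" "powers N \<subseteq> generate G {x}" using powers_in_cyclic[OF x] by blast
    obtain S where S: "separated_mod_powers (G\<lparr>carrier := A\<rparr>) 2 S" "card S = 2"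
      using separated_pair_exists[OF max tf nontriv] by blast
    \<comment> \<open>The upper bound is \<open>2 card \<H>\<close> for every \<open>e\<close>, so this \<open>e\<close> violates it.\<close>
    define e where "e = card \<H> * 2"
    obtain Y where Y: "separated_mod_powers (G\<lparr>carrier := A\<rparr>) (2 ^ e) Y" "card Y = 2 ^ e"
      using separated_powers[OF tf S(1), of e] S(2) by metis
    have "2 ^ e \<le> e"
      using bound[OF _ square_acts_trivially_if_virtually_cyclic[OF tf x(1) N t] Y(1)] Y(2)
      unfolding e_def by simp
    then show ?thesis using less_exp[of e] by linarith
  qed
qed

end

text \<open>If the torsion subgroup of \<open>A\<close> is nontrivial, then the quotient by it is virtually cyclic and,
  the torsion subgroup being finite, so is \<open>G\<close>.  Otherwise \<open>A\<close> is torsion-free, and counting applies.\<close>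

lemma (in group) virtually_cyclic_if_proper_quotients:
  assumes max: "max_condition G (carrier G)"
    and fin: "finite \<F>" and vc: "\<And>H. H \<in> \<F> \<Longrightarrow> vc_subgroup G H"
    and cover: "\<And>x. x \<in> carrier G \<Longrightarrow> \<exists>H\<in>\<F>. \<exists>g\<in>carrier G. \<exists>y\<in>H. x = conjugate G g y"
    and A: "A \<lhd> G" "A \<noteq> {\<one>}" and commute: "\<And>a b. a \<in> A \<Longrightarrow> b \<in> A \<Longrightarrow> a \<otimes> b = b \<otimes> a"
    and quot: "\<And>K. K \<lhd> G \<Longrightarrow> K \<noteq> {\<one>} \<Longrightarrow>
      \<exists>c\<in>carrier G. finitely_many_cosets G (K <#> generate G {c}) (carrier G)"
  shows "\<exists>c\<in>carrier G. finitely_many_cosets G (generate G {c}) (carrier G)"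
proof -
  interpret normal_abelian_subgroup G A 
    by (intro normal_abelian_subgroup.intro normal_abelian_subgroup_axioms.intro
        is_group A(1) commute)
  define T where "T = {a \<in> A. \<exists>n::nat>0. a [^] n = \<one>}"
  have T: "T \<lhd> G" "finite T" unfolding T_def using finite_torsion_normal[OF max] by auto
  show ?thesis
  proof (cases "T = {\<one>}")
    case False
    then show ?thesis using quot[OF T(1)] finite_normal_by_cyclic[OF T] by blast
  next
    case True
    then have tf: torsion_free unfolding torsion_free_def T_def by blast
    obtain t where t: "t \<in> carrier G" "finitely_many_cosets G (adjoin t) (carrier G)"
      using quot[OF A] unfolding adjoin_def by blast
    show ?thesis by (rule virtually_cyclic_if_torsion_free[OF max tf A(2) fin vc cover t])
  qed
qed

section \<open>Reduction to a quotient\<close>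

lemma (in group_hom) normal_image:
  assumes surj: "h ` carrier G = carrier H" and N: "N \<lhd> G"
  shows "h ` N \<lhd> H"
proof (rule H.normalI_conjugate)
  have NG: "subgroup N G" using N by (rule normal_imp_subgroup)
  show "subgroup (h ` N) H" using NG by (rule subgroup_img_is_subgroup)
  fix g y assume "g \<in> carrier H" "y \<in> h ` N"
  then obtain a b where ab: "a \<in> carrier G" "g = h a" "b \<in> N" "y = h b" using surj by blast
  have "b \<in> carrier G" using NG ab(3) by (simp add: subgroup.mem_carrier)
  then have "conjugate H g y = h (conjugate G a b)"
    using ab by (simp add: conjugate_def)
  then show "conjugate H g y \<in> h ` N"
    using G.normal_conjugate_closed[OF N ab(1,3)] by blast
qed

lemma (in group_hom) normal_preimage:
  assumes K: "K \<lhd> H" shows "{x \<in> carrier G. h x \<in> K} \<lhd> G"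
proof (rule G.normalI_conjugate)
  show "subgroup {x \<in> carrier G. h x \<in> K} G"
    using preimage_subgroup normal_imp_subgroup[OF K] by blast
  fix g x assume gx: "g \<in> carrier G" "x \<in> {x \<in> carrier G. h x \<in> K}"
  then have "h (conjugate G g x) = conjugate H (h g) (h x)" by (simp add: conjugate_def)
  then show "conjugate G g x \<in> {x \<in> carrier G. h x \<in> K}"
    using gx H.normal_conjugate_closed[OF K, of "h g" "h x"] by simp
qed

lemma (in group_hom) cyclic_cosets_image:
  assumes surj: "h ` carrier G = carrier H" and K: "K \<subseteq> carrier G" and c: "c \<in> carrier G"
    and fin: "finitely_many_cosets G (K <#>\<^bsub>G\<^esub> generate G {c}) (carrier G)"
  shows "finitely_many_cosets H (h ` K <#>\<^bsub>H\<^esub> generate H {h c}) (carrier H)"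
proof -
  have gen: "h ` generate G {c} = generate H {h c}"
    using generate_img[of "{c}"] c by simp
  have genG: "generate G {c} \<subseteq> carrier G" using c by (simp add: G.generate_incl)
  have sub: "h ` (K <#>\<^bsub>G\<^esub> generate G {c}) \<subseteq> h ` K <#>\<^bsub>H\<^esub> generate H {h c}"
  proof
    fix y assume "y \<in> h ` (K <#>\<^bsub>G\<^esub> generate G {c})"
    then obtain k d where kd: "k \<in> K" "d \<in> generate G {c}" "y = h (k \<otimes>\<^bsub>G\<^esub> d)"
      unfolding set_mult_def by blast
    then have "y = h k \<otimes>\<^bsub>H\<^esub> h d" using K genG by (simp add: subset_iff)
    moreover have "h d \<in> generate H {h c}" using kd(2) gen by blast
    ultimately show "y \<in> h ` K <#>\<^bsub>H\<^esub> generate H {h c}"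
      unfolding set_mult_def using kd(1) by blast
  qed
  have "K <#>\<^bsub>G\<^esub> generate G {c} \<subseteq> carrier G"
    using K genG by (rule G.set_mult_closed)
  then have "finitely_many_cosets H (h ` (K <#>\<^bsub>G\<^esub> generate G {c})) (carrier H)"
    using finitely_many_cosets_image[OF _ fin] surj by simp
  then show ?thesis
    by (rule H.finitely_many_cosets_mono[OF _ sub subset_refl])
qed

lemma (in group_hom) cyclic_cosets_preimage:
  assumes surj: "h ` carrier G = carrier H" and c: "c \<in> carrier G"
    and fin: "finitely_many_cosets H (generate H {h c}) (carrier H)"
  shows "finitely_many_cosets G (kernel G H h <#>\<^bsub>G\<^esub> generate G {c}) (carrier G)"
proof -
  obtain R where R: "finite R" "R \<subseteq> h ` carrier G"
    "\<And>g. g \<in> carrier H \<Longrightarrow> \<exists>k\<in>generate H {h c}. \<exists>r\<in>R. g = k \<otimes>\<^bsub>H\<^esub> r"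
    using fin surj unfolding finitely_many_cosets_def by auto
  obtain S where S: "S \<subseteq> carrier G" "finite S" "R = h ` S"
    using finite_subset_image[OF R(1,2)] by blast
  have "\<exists>k\<in>kernel G H h <#>\<^bsub>G\<^esub> generate G {c}. \<exists>s\<in>S. g = k \<otimes>\<^bsub>G\<^esub> s" if g: "g \<in> carrier G" for g
  proof -
    have hc: "h c \<in> carrier H" using c by simp
    obtain k r where kr: "k \<in> generate H {h c}" "r \<in> R" "h g = k \<otimes>\<^bsub>H\<^esub> r"
      using R(3)[of "h g"] g by auto
    obtain s where s: "s \<in> S" "r = h s" using kr(2) S(3) by blast
    obtain i :: int where i: "k = h c [^]\<^bsub>H\<^esub> i"
      using kr(1) unfolding H.generate_pow[OF hc] by blast
    have sG: "s \<in> carrier G" using s(1) S(1) by blast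
    define d where "d = c [^]\<^bsub>G\<^esub> i"
    have d: "d \<in> carrier G" "d \<in> generate G {c}"
      unfolding d_def G.generate_pow[OF c] using c by auto
    define m where "m = g \<otimes>\<^bsub>G\<^esub> inv\<^bsub>G\<^esub> (d \<otimes>\<^bsub>G\<^esub> s)"
    have hg: "h g = h (d \<otimes>\<^bsub>G\<^esub> s)"
      using kr(3) i s(2) sG c unfolding d_def by (simp add: hom_int_pow)
    have "m \<in> kernel G H h"
      unfolding m_def kernel_def using g d sG hg by (simp del: hom_mult add: hom_mult[of g])
    moreover have "g = (m \<otimes>\<^bsub>G\<^esub> d) \<otimes>\<^bsub>G\<^esub> s"
      unfolding m_def using g d sG by (simp add: G.m_assoc G.inv_mult_group)
    ultimately show ?thesis using d(2) s(1) unfolding set_mult_def by blast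
  qed
  then show ?thesis
    unfolding finitely_many_cosets_def using S by (intro exI[of _ S]) simp
qed

text \<open>The argument by contradiction takes place in the quotient by a normal subgroup \<open>M\<close> that is maximal
  among those with a quotient that is not virtually cyclic.\<close>

lemma (in group) virtually_cyclic_if_conjugacy_cover:
  assumes max: "max_condition G (carrier G)"
    and D: "\<And>i. D i \<lhd> G" "D n = {\<one>}" "finitely_many_cosets G (D 0) (carrier G)"
      "\<And>i x y. x \<in> D i \<Longrightarrow> y \<in> D i \<Longrightarrow> x \<otimes> y \<otimes> inv x \<otimes> inv y \<in> D (Suc i)"
    and fin: "finite \<F>" and vc: "\<And>H. H \<in> \<F> \<Longrightarrow> vc_subgroup G H"
    and cover: "\<And>x. x \<in> carrier G \<Longrightarrow> \<exists>H\<in>\<F>. \<exists>g\<in>carrier G. \<exists>y\<in>H. x = conjugate G g y"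
  shows "virtually_cyclic G"
proof (rule ccontr)
  assume not_vc: "\<not> virtually_cyclic G"
  define P where "P M \<longleftrightarrow> M \<lhd> G \<and>
    \<not> (\<exists>c\<in>carrier G. finitely_many_cosets G (M <#> generate G {c}) (carrier G))" for M
  have "P {\<one>}"
    unfolding P_def
  proof (intro conjI one_is_normal notI)
    assume "\<exists>c\<in>carrier G. finitely_many_cosets G ({\<one>} <#> generate G {c}) (carrier G)"
    then obtain c where c: "c \<in> carrier G"
      "finitely_many_cosets G ({\<one>} <#> generate G {c}) (carrier G)" by blast
    have "generate G {c} \<subseteq> carrier G" using c(1) by (simp add: generate_incl)
    then have "{\<one>} <#> generate G {c} = generate G {c}"
      using lcos_mult_one by (simp flip: l_coset_eq_set_mult)
    then show False using c virtually_cyclicI not_vc by metis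
  qed
  then obtain M where M: "P M" and maximal: "\<And>L. P L \<Longrightarrow> M \<subseteq> L \<Longrightarrow> L = M"
    using max_condition_maximal[OF max, of P] normal_imp_subgroup unfolding P_def by metis
  have MG: "M \<lhd> G" using M unfolding P_def by blast
  interpret M: normal M G by (rule MG)
  let ?Q = "G Mod M"
  define h where "h = (\<lambda>a. M #> a)"
  interpret Q: group ?Q by (rule M.factorgroup_is_group)
  interpret h: group_hom G ?Q h
    unfolding h_def by (intro group_hom.intro group_hom_axioms.intro is_group Q.is_group M.r_coset_hom_Mod)
  have surj: "h ` carrier G = carrier ?Q" unfolding h_def carrier_FactGroup by simp
  have ker: "h x = \<one>\<^bsub>?Q\<^esub> \<longleftrightarrow> x \<in> M" if "x \<in> carrier G" for x
    unfolding h_def using that rcos_self[OF that M.subgroup_axioms] coset_join2[OF that M.subgroup_axioms] by auto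
  have kernel: "kernel G ?Q h = M"
    unfolding kernel_def using ker M.subset by blast
  have not_D0: "\<not> D 0 \<subseteq> M"
  proof
    assume "D 0 \<subseteq> M"
    moreover have "M \<subseteq> M <#> generate G {\<one>}"
      unfolding generate_one set_mult_def using M.subset by (auto simp: subset_iff intro!: bexI)
    ultimately have "finitely_many_cosets G (M <#> generate G {\<one>}) (carrier G)"
      using finitely_many_cosets_mono[OF D(3) _ subset_refl] by (meson order_trans)
    then show False using M unfolding P_def by blast
  qed
  have "D n \<subseteq> M" using D(2) M.one_closed by simp
  \<comment> \<open>The term of the series just before the first one inside \<open>M\<close> has a nontrivial abelian image.\<close>
  define k where "k = (LEAST i. D i \<subseteq> M)"
  have k: "D k \<subseteq> M" unfolding k_def using \<open>D n \<subseteq> M\<close> by (rule LeastI)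
  then obtain j where j: "k = Suc j" using not_D0 by (cases k) auto
  have jM: "\<not> D j \<subseteq> M" using not_less_Least[of j "\<lambda>i. D i \<subseteq> M"] j unfolding k_def by simp
  have DG: "D j \<subseteq> carrier G" using D(1) normal_imp_subgroup subgroup.subset by blast
  have "\<exists>c\<in>carrier ?Q. finitely_many_cosets ?Q (generate ?Q {c}) (carrier ?Q)"
  proof (rule Q.virtually_cyclic_if_proper_quotients)
    show "max_condition ?Q (carrier ?Q)" by (rule h.max_condition_image[OF surj max])
    show "finite ((`) h ` \<F>)" using fin by simp
    show "vc_subgroup ?Q K" if "K \<in> (`) h ` \<F>" for K
      using that vc h.vc_subgroup_image by blast
    show "\<exists>K\<in>(`) h ` \<F>. \<exists>g\<in>carrier ?Q. \<exists>y\<in>K. x = conjugate ?Q g y" if x: "x \<in> carrier ?Q" for x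
    proof -
      obtain a where a: "a \<in> carrier G" "x = h a" using x surj by blast
      obtain H g y where H: "H \<in> \<F>" "g \<in> carrier G" "y \<in> H" "a = conjugate G g y"
        using cover[OF a(1)] by blast
      have "y \<in> carrier G"
        using vc[OF H(1)] H(3) unfolding vc_subgroup_def by (auto simp: subgroup.mem_carrier)
      then have "x = conjugate ?Q (h g) (h y)"
        unfolding a(2) H(4) conjugate_def using H(2) by (simp del: mult_FactGroup)
      then have "\<exists>g\<in>carrier ?Q. \<exists>y\<in>h ` H. x = conjugate ?Q g y" using H h.hom_closed by blast
      then show ?thesis by (intro bexI[of _ "h ` H"] imageI H(1))
    qed
    show "h ` D j \<lhd> ?Q" by (rule h.normal_image[OF surj D(1)])
    obtain x where "x \<in> D j" "x \<notin> M" using jM by blast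
    then have "h x \<in> h ` D j" "h x \<noteq> \<one>\<^bsub>?Q\<^esub>" using ker DG by auto
    then show "h ` D j \<noteq> {\<one>\<^bsub>?Q\<^esub>}" by (metis singletonD)
    show "a \<otimes>\<^bsub>?Q\<^esub> b = b \<otimes>\<^bsub>?Q\<^esub> a" if ab: "a \<in> h ` D j" "b \<in> h ` D j" for a b
    proof -
      obtain x y where xy: "x \<in> D j" "y \<in> D j" "a = h x" "b = h y" using ab by blast
      have G: "x \<in> carrier G" "y \<in> carrier G" using xy DG by auto
      have "x \<otimes> y \<otimes> inv x \<otimes> inv y \<in> M" using D(4)[OF xy(1,2)] k j by blast
      moreover have "x \<otimes> y \<otimes> inv x \<otimes> inv y \<in> carrier G" using G by simp
      ultimately have "h (x \<otimes> y \<otimes> inv x \<otimes> inv y) = \<one>\<^bsub>?Q\<^esub>" using ker by blast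
      moreover have "h (y \<otimes> x) \<in> carrier ?Q" using G by (intro h.hom_closed m_closed)
      ultimately have "h (x \<otimes> y \<otimes> inv x \<otimes> inv y) \<otimes>\<^bsub>?Q\<^esub> h (y \<otimes> x) = h (y \<otimes> x)"
        using Q.l_one by metis
      moreover have "h (x \<otimes> y \<otimes> inv x \<otimes> inv y) \<otimes>\<^bsub>?Q\<^esub> h (y \<otimes> x)
          = h (x \<otimes> y \<otimes> inv x \<otimes> inv y \<otimes> (y \<otimes> x))"
        using G by (intro h.hom_mult[symmetric]) auto
      moreover have "x \<otimes> y \<otimes> inv x \<otimes> inv y \<otimes> (y \<otimes> x) = x \<otimes> y"
        using G by (simp add: m_assoc)
      ultimately have "h (x \<otimes> y) = h (y \<otimes> x)" by metis
      then show ?thesis unfolding xy(3,4) using G h.hom_mult by metis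
    qed
    show "\<exists>c\<in>carrier ?Q. finitely_many_cosets ?Q (K <#>\<^bsub>?Q\<^esub> generate ?Q {c}) (carrier ?Q)"
      if K: "K \<lhd> ?Q" "K \<noteq> {\<one>\<^bsub>?Q\<^esub>}" for K
    proof -
      define L where "L = {x \<in> carrier G. h x \<in> K}"
      have sK: "subgroup K ?Q" using K(1) by (rule normal_imp_subgroup)
      have "K \<subseteq> h ` carrier G" using subgroup.subset[OF sK] surj by simp
      then have hL: "h ` L = K" unfolding L_def by blast
      have hM: "h x = \<one>\<^bsub>?Q\<^esub>" if "x \<in> M" for x using ker M.subset that by blast
      have "x \<in> L" if "x \<in> M" for x
        unfolding L_def mem_Collect_eq hM[OF that]
        using that M.subset subgroup.one_closed[OF sK] by blast
      then have "M \<subseteq> L" by blast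
      moreover have "L \<noteq> M"
      proof
        assume "L = M"
        then have "K = h ` M" using hL by simp
        then have "K \<subseteq> {\<one>\<^bsub>?Q\<^esub>}" using hM by blast
        then show False using K(2) subgroup.one_closed[OF sK] by blast
      qed
      ultimately have "\<not> P L" using maximal by blast
      moreover have "L \<lhd> G" unfolding L_def by (rule h.normal_preimage[OF K(1)])
      ultimately obtain c where c: "c \<in> carrier G"
        "finitely_many_cosets G (L <#> generate G {c}) (carrier G)" unfolding P_def by blast
      have "L \<subseteq> carrier G" unfolding L_def by blast
      from h.cyclic_cosets_image[OF surj this c]
      show ?thesis using hL h.hom_closed[OF c(1)] by blast
    qed
  qed
  then obtain c where c: "c \<in> carrier G" "finitely_many_cosets ?Q (generate ?Q {h c}) (carrier ?Q)"
    using surj by (metis imageE)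
  have "finitely_many_cosets G (M <#> generate G {c}) (carrier G)"
    using h.cyclic_cosets_preimage[OF surj c] unfolding kernel .
  then show False using M c(1) unfolding P_def by blast
qed

theorem corollary4p8:
  fixes G :: "('a, 'b) monoid_scheme" and n :: nat and H :: "nat \<Rightarrow> 'a set"
  assumes "group G"
    and "polycyclic_by_finite G"
    and "\<And>i. i \<in> {1..n} \<Longrightarrow> subgroup (H i) G"
    and "\<And>i. i \<in> {1..n} \<Longrightarrow> virtually_cyclic (G\<lparr>carrier := H i\<rparr>)"
    and "\<And>K. subgroup K G \<Longrightarrow> virtually_cyclic (G\<lparr>carrier := K\<rparr>) \<Longrightarrow>
           \<exists>i\<in>{1..n}. \<exists>L. subgroup L G \<and> L \<subseteq> H i \<and> conjugate_in G K L"
  shows "virtually_cyclic G"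
proof -
  interpret group G by (rule assms(1))
  obtain D :: "nat \<Rightarrow> 'a set" and m where D:
    "\<And>i. D i \<lhd> G" "D m = {\<one>\<^bsub>G\<^esub>}" "finitely_many_cosets G (D 0) (carrier G)"
    "\<And>i x y. x \<in> D i \<Longrightarrow> y \<in> D i \<Longrightarrow>
      x \<otimes>\<^bsub>G\<^esub> y \<otimes>\<^bsub>G\<^esub> inv\<^bsub>G\<^esub> x \<otimes>\<^bsub>G\<^esub> inv\<^bsub>G\<^esub> y \<in> D (Suc i)"
    using polycyclic_by_finite_derived_series[OF assms(2)] by blast
  show ?thesis
  proof (rule virtually_cyclic_if_conjugacy_cover[OF polycyclic_by_finite_max_condition[OF assms(2)] D])
    show "finite (H ` {1..n})" by simp
    show "vc_subgroup G K" if "K \<in> H ` {1..n}" for K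
      using that assms(3,4) vc_subgroupI by blast
    show "\<exists>K\<in>H ` {1..n}. \<exists>g\<in>carrier G. \<exists>y\<in>K. x = conjugate G g y" if x: "x \<in> carrier G" for x
    proof -
      have "subgroup (generate G {x}) G" using x by (simp add: generate_is_subgroup)
      then obtain i L g where i: "i \<in> {1..n}" "L \<subseteq> H i" "g \<in> carrier G"
        "L = g <#\<^bsub>G\<^esub> generate G {x} #>\<^bsub>G\<^esub> inv\<^bsub>G\<^esub> g"
        using assms(5)[OF _ virtually_cyclic_generate[OF x]] unfolding conjugate_in_def by blast
      have "conjugate G g x \<in> L"
        unfolding i(4) conjugate_def l_coset_def r_coset_def by (auto intro: generate.incl)
      then have "conjugate G g x \<in> H i" using i(2) by blast
      moreover have "x = conjugate G (inv\<^bsub>G\<^esub> g) (conjugate G g x)" using i(3) x by simp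
      ultimately show ?thesis using i(1,3) by blast
    qed
  qed
qed

end
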